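(* Let $G$ be a (finite) tree. Then the independence complex $\operatorname{Ind}(G)$ is contractible if and only if $G$ is reducible to a path $P_n$ with $n \equiv 1 \pmod 3$.
   Context: All graphs are finite and simple. $P_n$ denotes the path on $n$ vertices. The independence complex $\operatorname{Ind}(G)$ is the simplicial complex on the vertex set of $G$ whose faces are the independent sets of $G$ (sets of pairwise nonadjacent vertices). A vertex $u$ of $G$ is a branching point if $\deg_G(u) > 2$, and a leaf if $\deg_G(u)=1$. For a branching point $u$, a pure branch at $u$ is a path starting at $u$ and ending at a leaf of $G$ such that every vertex of the path other than $u$ has degree at most $2$ in $G$. The length of a branch is its number of edges (equivalently, the number of its vertices other than $u$), and its type is the residue of its length modulo $3$ (so type $0$, $1$ or $2$). Removing a branch at $u$ means deleting all of its vertices except $u$. Moves at a branching point $u$ of $G$: (1) If there exist a pure branch of type $1$ and a pure branch of type $2$ at $u$, remove all vertices of $G$ except those belonging to these two branches (the vertex $u$ is kept). (2) If there is more than one pure branch of the same type at $u$, remove all but one such branch (the vertex $u$ is kept). (3) If $P$ is a pure branch at $u$ of type $0$, remove all vertices of $P$ except $u$. $G$ is reducible to $H$ if $H$ (up to isomorphism) is obtained from $G$ by a finite (possibly empty) sequence of such moves, each performed at a branching point of the current graph. *)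

theory Defs
  imports
    "HOL-Analysis.Analysis"
    "Graph_Theory.Graph_Theory"
begin

text \<open>
  A finite simple graph is a symmetric digraph satisfying the locale predicate \<^const>\<open>graph\<close>:
  every edge is a pair of opposite arcs, so \<^const>\<open>out_degree\<close> is the degree, and
  \<^const>\<open>arcs_ends\<close> is the adjacency relation.  In such a digraph \<open>u, v, u\<close> is a directed cycle
  for every edge \<open>{u, v}\<close>, so \<^const>\<open>forest\<close> and \<^const>\<open>tree\<close> of the library do not express the
  undirected notions; an undirected cycle is a directed cycle with at least three arcs.
\<close>

definition undirected_tree :: "('a, 'b) pre_digraph \<Rightarrow> bool" where
  "undirected_tree G \<longleftrightarrow>
     graph G \<and> Digraph_Component.connected G \<and>
     \<not> (\<exists>p. pre_digraph.cycle G p \<and> length p \<ge> 3)"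

definition path_graph :: "nat \<Rightarrow> (nat, nat \<times> nat) pre_digraph" where
  "path_graph n =
     \<lparr> verts = {..<n},
       arcs = {(i, j). i < n \<and> j < n \<and> (j = Suc i \<or> i = Suc j)},
       tail = fst, head = snd \<rparr>"


definition independence_complex :: "('a, 'b) pre_digraph \<Rightarrow> 'a set set" where
  "independence_complex G =
     {S. S \<subseteq> verts G \<and> pairwise (\<lambda>u v. (u, v) \<notin> arcs_ends G) S}"

text \<open>
  Geometric realization of a simplicial complex with finitely many vertices (for infinitely many
  vertices the product topology below would not be the customary one), in barycentric coordinates.
  It does not matter whether the empty face belongs to \<open>K\<close>, since the coordinates sum to 1.
\<close>

definition geometric_realization :: "'a set set \<Rightarrow> ('a \<Rightarrow> real) topology" where
  "geometric_realization K =
     subtopology (powertop_real UNIV)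
       {x. (\<forall>v. 0 \<le> x v) \<and> {v. x v \<noteq> 0} \<in> K \<and> (\<Sum>v | x v \<noteq> 0. x v) = 1}"


definition branching_point :: "('a, 'b) pre_digraph \<Rightarrow> 'a \<Rightarrow> bool" where
  "branching_point G u \<longleftrightarrow> u \<in> verts G \<and> out_degree G u > 2"

definition leaf :: "('a, 'b) pre_digraph \<Rightarrow> 'a \<Rightarrow> bool" where
  "leaf G u \<longleftrightarrow> u \<in> verts G \<and> out_degree G u = 1"

text \<open>
  A branch at \<open>u\<close> is the list of its vertices, beginning with \<open>u\<close>.
\<close>

definition pure_branch :: "('a, 'b) pre_digraph \<Rightarrow> 'a \<Rightarrow> 'a list \<Rightarrow> bool" where
  "pure_branch G u p \<longleftrightarrow>
     branching_point G u \<and> vpath p G \<and> hd p = u \<and> leaf G (last p) \<and>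
     (\<forall>v \<in> set p - {u}. out_degree G v \<le> 2)"

definition branch_type :: "'a list \<Rightarrow> nat" where
  "branch_type p = vwalk_length p mod 3"

inductive move :: "('a, 'b) pre_digraph \<Rightarrow> ('a, 'b) pre_digraph \<Rightarrow> bool" where
  keep_types_1_2:
    "\<lbrakk> pure_branch G u p; branch_type p = 1; pure_branch G u q; branch_type q = 2 \<rbrakk>
      \<Longrightarrow> move G (G \<restriction> (set p \<union> set q))"
| keep_one_of_type:
    "\<lbrakk> B = {q. pure_branch G u q \<and> branch_type q = t}; p \<in> B; B \<noteq> {p} \<rbrakk>
      \<Longrightarrow> move G (G \<restriction> (verts G - (\<Union>q \<in> B - {p}. set q - {u})))"
| remove_type_0:
    "\<lbrakk> pure_branch G u p; branch_type p = 0 \<rbrakk>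
      \<Longrightarrow> move G (G \<restriction> (verts G - (set p - {u})))"

definition reducible_to :: "('a, 'b) pre_digraph \<Rightarrow> ('c, 'd) pre_digraph \<Rightarrow> bool" where
  "reducible_to G H \<longleftrightarrow> (\<exists>K. move\<^sup>*\<^sup>* G K \<and> digraph_iso K H)"

end

theory Submission
  imports Defs "HOL-Homology.Brouwer_Degree"
begin

text \<open>
  The sum of $(-1)^{|S|}$ over the independent sets $S$ (up to sign the reduced Euler
  characteristic of the independence complex) decides contractibility for a forest.  Indeed, if
  $N(a) \subseteq N(b)$, then $b$ can be deleted without changing the homotopy type of the complex
  or the signed count, and such deletions turn a forest either into a graph with an isolated
  vertex, whose complex is a cone and whose count is 0, or into a perfect matching, whose complex is
  a sphere and whose count is $\pm 1$.

  For a leaf with neighbour $w$ the signed count of $G$ is minus that of $G - N[w]$.  Hence a branch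
  of length $k$ matters only through $k$ modulo 3, every move preserves whether the count vanishes,
  and for $P_n$ the count vanishes exactly for $n \equiv 1 \pmod 3$.  Finally, a tree with a
  branching point has one with two pure branches, so some move applies to it, and every tree
  is reducible to a path.
\<close>

section \<open>The signed count of independent sets\<close>

text \<open>The moves do not preserve the homotopy type: removing a branch of type 0 can change the
  dimension of a sphere, and the first move discards an arbitrary part of the tree. Only the
  vanishing of the signed count survives. For general complexes a vanishing Euler characteristic
  does not imply contractibility; here it does because a forest leaves no third possibility. The
  first move is harmless since the leaf rule along the branch of type 2 deletes the root, and the
  branch of type 1 then remains as a path of zero count, whatever else the tree contains. Invariance
  holds along every sequence of moves, so both directions follow from it once a single reduction to
  a path is known to exist. Counting is done for vertex sets \<open>U\<close> under one fixed
  relation \<open>E\<close>, which makes deletion a set difference; graphs enter only in the last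
  section.\<close>

definition nbrs :: "('a \<Rightarrow> 'a \<Rightarrow> bool) \<Rightarrow> 'a set \<Rightarrow> 'a \<Rightarrow> 'a set" where
  "nbrs E U v = {w \<in> U. E v w}"

definition indep_sets :: "('a \<Rightarrow> 'a \<Rightarrow> bool) \<Rightarrow> 'a set \<Rightarrow> 'a set set" where
  "indep_sets E U = {S. S \<subseteq> U \<and> pairwise (\<lambda>u v. \<not> E u v) S}"

definition alt_count :: "('a \<Rightarrow> 'a \<Rightarrow> bool) \<Rightarrow> 'a set \<Rightarrow> int" where
  "alt_count E U = (\<Sum>S\<in>indep_sets E U. (-1) ^ card S)"

lemma nbrs_Diff: "nbrs E (U - X) v = nbrs E U v - X"
  by (auto simp: nbrs_def)

lemma finite_nbrs: "finite U \<Longrightarrow> finite (nbrs E U v)"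
  by (simp add: nbrs_def)

lemma finite_indep_sets: "finite U \<Longrightarrow> finite (indep_sets E U)"
  by (rule finite_subset[of _ "Pow U"]) (auto simp: indep_sets_def)

lemma indep_sets_cong:
  assumes "\<And>x y. x \<in> U \<Longrightarrow> y \<in> U \<Longrightarrow> E x y \<longleftrightarrow> E' x y"
  shows "indep_sets E U = indep_sets E' U"
  using assms unfolding indep_sets_def pairwise_def by (auto simp: subset_iff)

lemma alt_cong:
  assumes "\<And>x y. x \<in> U \<Longrightarrow> y \<in> U \<Longrightarrow> E x y \<longleftrightarrow> E' x y"
  shows "alt_count E U = alt_count E' U"
  unfolding alt_count_def using indep_sets_cong[of U E E'] assms by simp

locale simple_graph =
  fixes E :: "'a \<Rightarrow> 'a \<Rightarrow> bool"
  assumes adj_sym: "E x y \<Longrightarrow> E y x" and adj_irrefl: "\<not> E x x"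
begin

lemma nbrs_sym: "x \<in> U \<Longrightarrow> y \<in> nbrs E U x \<Longrightarrow> x \<in> nbrs E U y"
  by (auto simp: nbrs_def adj_sym)

lemma nbrs_irrefl: "v \<notin> nbrs E U v"
  by (simp add: nbrs_def adj_irrefl)

text \<open>Independent sets are split by whether they contain \<open>v\<close>. Removing
  \<open>v\<close> from one that does leaves an independent set outside the closed neighbourhood,
  with the opposite sign. In the complex these are the deletion and the link of
  \<open>v\<close>.\<close>

lemma alt_delete:
  assumes "finite U" "v \<in> U"
  shows "alt_count E U = alt_count E (U - {v}) - alt_count E (U - insert v (nbrs E U v))"
proof -
  let ?W = "U - insert v (nbrs E U v)"
  have eq: "indep_sets E U = indep_sets E (U - {v}) \<union> insert v ` indep_sets E ?W" (is "_ = ?A \<union> ?B")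
  proof
    show "indep_sets E U \<subseteq> ?A \<union> ?B"
    proof
      fix S assume S: "S \<in> indep_sets E U"
      show "S \<in> ?A \<union> ?B"
      proof (cases "v \<in> S")
        case True
        have "S - {v} \<in> indep_sets E ?W"
          using S True by (auto simp: indep_sets_def nbrs_def pairwise_def)
        moreover have "S = insert v (S - {v})" using True by auto
        ultimately show ?thesis by blast
      next
        case False
        then show ?thesis using S by (auto simp: indep_sets_def)
      qed
    qed
    show "?A \<union> ?B \<subseteq> indep_sets E U"
      using assms(2) by (auto simp: indep_sets_def nbrs_def pairwise_def dest: adj_sym)
  qed
  have disj: "?A \<inter> ?B = {}" by (auto simp: indep_sets_def)
  have inj: "inj_on (insert v) (indep_sets E ?W)"
    by (rule inj_onI) (auto simp: indep_sets_def dest!: insert_eq_iff[THEN iffD1, rotated 2])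
  have "(\<Sum>S\<in>?B. (-1) ^ card S) = (\<Sum>S\<in>indep_sets E ?W. (-1) ^ card (insert v S) :: int)"
    by (simp add: sum.reindex[OF inj])
  also have "\<dots> = (\<Sum>S\<in>indep_sets E ?W. - ((-1) ^ card S))"
  proof (rule sum.cong)
    fix S assume "S \<in> indep_sets E ?W"
    then have "v \<notin> S" "finite S" using assms(1) by (auto simp: indep_sets_def intro: finite_subset)
    then show "(-1) ^ card (insert v S) = - ((-1::int) ^ card S)" by simp
  qed simp
  finally have B: "(\<Sum>S\<in>?B. (-1) ^ card S) = - alt_count E ?W"
    by (simp add: alt_count_def sum_negf)
  show ?thesis
    unfolding alt_count_def[of E U] eq
    by (subst sum.union_disjoint) (use assms(1) disj B in \<open>auto simp: finite_indep_sets alt_count_def\<close>)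
qed

text \<open>Deletion and link of an isolated vertex coincide, so the two terms of
  \<open>alt_delete\<close> cancel.\<close>

lemma alt_isolated:
  assumes "finite U" "v \<in> U" "nbrs E U v = {}"
  shows "alt_count E U = 0"
  using alt_delete[OF assms(1,2)] assms(3) by simp

text \<open>The link of \<open>b\<close> contributes nothing: \<open>a\<close> is not adjacent to
  \<open>b\<close>, since otherwise \<open>b\<close> would be its own neighbour, so \<open>a\<close>
  survives there and is isolated.\<close>

lemma alt_fold:
  assumes "finite U" "a \<in> U" "b \<in> U" "a \<noteq> b" "nbrs E U a \<subseteq> nbrs E U b"
  shows "alt_count E U = alt_count E (U - {b})"
proof -
  have "a \<notin> nbrs E U b"
    using assms(2,3,5) nbrs_sym nbrs_irrefl by blast
  then have "alt_count E (U - insert b (nbrs E U b)) = 0"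
    using assms by (intro alt_isolated[where v = a]) (auto simp: nbrs_Diff)
  then show ?thesis using alt_delete[OF assms(1,3)] by simp
qed

text \<open>The recursion is applied at \<open>w\<close> rather than at the leaf, because deleting
  \<open>w\<close> isolates \<open>l\<close>.\<close>

lemma alt_leaf:
  assumes "finite U" "l \<in> U" "nbrs E U l = {w}"
  shows "alt_count E U = - alt_count E (U - insert w (nbrs E U w))"
proof -
  have w: "w \<in> U" "w \<noteq> l" using assms(3) nbrs_irrefl[of l U] by (auto simp: nbrs_def)
  have "alt_count E (U - {w}) = 0"
    by (rule alt_isolated[where v = l]) (use assms w in \<open>auto simp: nbrs_Diff\<close>)
  then show ?thesis using alt_delete[OF assms(1) w(1)] by simp
qed

end

section \<open>Pendant paths\<close>

text \<open>
  A branch is read from its leaf towards its root: \<open>thread E U P zs\<close> says that every vertex of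
  \<open>zs\<close> except the last is adjacent in \<open>U\<close> to exactly its neighbours in \<open>zs\<close>, the first one being
  also adjacent to the vertices of \<open>P\<close> (the predecessor of \<open>zs\<close>, if any).  Nothing is said about
  the last vertex.
\<close>

fun thread :: "('a \<Rightarrow> 'a \<Rightarrow> bool) \<Rightarrow> 'a set \<Rightarrow> 'a set \<Rightarrow> 'a list \<Rightarrow> bool" where
  "thread E U P (z # z' # zs) \<longleftrightarrow> nbrs E U z = insert z' P \<and> thread E U {z} (z' # zs)"
| "thread E U P zs \<longleftrightarrow> True"

text \<open>The root \<open>u\<close> is kept out of \<open>ys\<close>, so that
  \<open>set ys\<close> is exactly what a move deletes and \<open>length ys\<close> is the length of
  the branch. The empty predecessor set makes the head of \<open>ys\<close> a leaf.\<close>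

definition pendant :: "('a \<Rightarrow> 'a \<Rightarrow> bool) \<Rightarrow> 'a set \<Rightarrow> 'a list \<Rightarrow> 'a \<Rightarrow> bool" where
  "pendant E U ys u \<longleftrightarrow>
     ys \<noteq> [] \<and> thread E U {} (ys @ [u]) \<and> distinct (ys @ [u]) \<and> set (ys @ [u]) \<subseteq> U"

lemma thread_Diff: "thread E U P zs \<Longrightarrow> X \<inter> set zs = {} \<Longrightarrow> thread E (U - X) (P - X) zs"
proof (induction E U P zs rule: thread.induct)
  case (1 E U P z z' zs)
  have "{z} - X = {z}" using 1 by auto
  with 1 show ?case by (auto simp: nbrs_Diff)
qed auto

lemma thread_appendD: "thread E U P (zs @ zs') \<Longrightarrow> thread E U P zs"
proof (induction zs arbitrary: P)
  case (Cons z zs)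
  then show ?case by (cases zs) auto
qed simp

lemma thread_nbrs:
  "thread E U P (zs @ [u]) \<Longrightarrow> x \<in> set zs \<Longrightarrow> nbrs E U x \<subseteq> insert u (P \<union> set zs)"
proof (induction zs arbitrary: P)
  case (Cons z zs)
  show ?case
  proof (cases zs)
    case Nil
    then show ?thesis using Cons by auto
  next
    case (Cons z' zs')
    have "thread E U {z} (zs @ [u])" "nbrs E U z = insert z' P"
      using Cons Cons.prems by auto
    then show ?thesis using Cons.IH[of "{z}"] Cons.prems(2) Cons by auto
  qed
qed simp

text \<open>A branch contains at most one neighbour of its root. This turns statements about
  neighbours of the root into statements about branches.\<close>

lemma thread_nbrs_last:
  "thread E U P (zs @ [u]) \<Longrightarrow> x \<in> set zs \<Longrightarrow> u \<in> nbrs E U x \<Longrightarrow> u \<notin> P \<Longrightarrow> u \<notin> set zs \<Longrightarrow> x = last zs"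
proof (induction zs arbitrary: P)
  case (Cons z zs)
  have *: "thread E U {z} (zs @ [u])" "nbrs E U z = insert (hd (zs @ [u])) P"
    using Cons.prems by (cases zs; simp)+
  show ?case
  proof (cases "x = z")
    case True
    then have "u = hd (zs @ [u])" using *(2) Cons.prems(3,4) by auto
    then have "zs = []" using Cons.prems(5) by (cases zs) auto
    then show ?thesis using True by simp
  next
    case False
    then have "x \<in> set zs" using Cons.prems(2) by simp
    moreover have "x = last zs"
      by (rule Cons.IH[OF *(1)]) (use Cons.prems \<open>x \<in> set zs\<close> in auto)
    ultimately show ?thesis by auto
  qed
qed simp

lemma thread_card_nbrs:
  "thread E U P (zs @ [u]) \<Longrightarrow> x \<in> set zs \<Longrightarrow> finite P \<Longrightarrow> card P \<le> 1 \<Longrightarrow> card (nbrs E U x) \<le> 2"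
proof (induction zs arbitrary: P)
  case (Cons z zs)
  have *: "thread E U {z} (zs @ [u])" "nbrs E U z = insert (hd (zs @ [u])) P"
    using Cons.prems by (cases zs; simp)+
  show ?case
  proof (cases "x = z")
    case True
    then show ?thesis using * Cons.prems by (simp add: card_insert_if)
  next
    case False
    then show ?thesis using Cons.IH[OF *(1)] Cons.prems by auto
  qed
qed simp

text \<open>Applied to a branch without its first vertex, this shows that the first vertex is the
  only leaf in it.\<close>

lemma thread_card_nbrs_eq:
  "thread E U P (zs @ [u]) \<Longrightarrow> x \<in> set zs \<Longrightarrow> distinct (zs @ [u]) \<Longrightarrow> P \<inter> set (zs @ [u]) = {} \<Longrightarrow> card P = 1
    \<Longrightarrow> card (nbrs E U x) = 2"
proof (induction zs arbitrary: P)
  case (Cons z zs)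
  have *: "thread E U {z} (zs @ [u])" "nbrs E U z = insert (hd (zs @ [u])) P"
    using Cons.prems by (cases zs; simp)+
  have "hd (zs @ [u]) \<notin> P" using Cons.prems(4) by (cases zs) auto
  moreover have "finite P" using Cons.prems(5) by (simp add: card_ge_0_finite)
  ultimately have "card (nbrs E U z) = 2" using * Cons.prems(5) by simp
  moreover have ?case if "x \<noteq> z"
    using Cons.IH[OF *(1)] Cons.prems that by auto
  ultimately show ?case by auto
qed simp

text \<open>The next vertex is always the one neighbour that is not the predecessor, so the common
  start determines everything up to \<open>u\<close>. Disjointness from \<open>P\<close> keeps
  successor and predecessor apart.\<close>

lemma thread_unique:
  "thread E U P (zs @ [u]) \<Longrightarrow> thread E U P (zs' @ [u]) \<Longrightarrow> hd (zs @ [u]) = hd (zs' @ [u])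
   \<Longrightarrow> distinct (zs @ [u]) \<Longrightarrow> distinct (zs' @ [u])
   \<Longrightarrow> P \<inter> set (zs @ [u]) = {} \<Longrightarrow> P \<inter> set (zs' @ [u]) = {} \<Longrightarrow> zs = zs'"
proof (induction zs arbitrary: P zs')
  case Nil
  then show ?case by (cases zs') auto
next
  case (Cons z zs)
  then obtain ws where zs': "zs' = z # ws" by (cases zs') auto
  have *: "thread E U {z} (zs @ [u])" "nbrs E U z = insert (hd (zs @ [u])) P"
    using Cons.prems(1) by (cases zs; simp)+
  have **: "thread E U {z} (ws @ [u])" "nbrs E U z = insert (hd (ws @ [u])) P"
    using Cons.prems(2) unfolding zs' by (cases ws; simp)+
  have "hd (zs @ [u]) \<notin> P" "hd (ws @ [u]) \<notin> P"
    using Cons.prems(6,7) unfolding zs' by (cases zs; cases ws; auto)+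
  then have "hd (zs @ [u]) = hd (ws @ [u])" using *(2) **(2) by auto
  then have "zs = ws"
    using Cons.IH[OF *(1) **(1)] Cons.prems(4,5) unfolding zs' by auto
  then show ?case by (simp add: zs')
qed

lemma thread_successively: "thread E U P zs \<Longrightarrow> successively (\<lambda>x y. y \<in> nbrs E U x) zs"
  by (induction E U P zs rule: thread.induct) auto

lemma pendant_Diff:
  assumes "pendant E U ys u" "X \<inter> set (ys @ [u]) = {}"
  shows "pendant E (U - X) ys u"
  using assms thread_Diff[of E U "{}" "ys @ [u]" X] by (auto simp: pendant_def)

section \<open>Effect of pendant paths on the signed count\<close>

context simple_graph
begin

text \<open>The leaf rule removes three vertices at a time from the free end of the branch.\<close>

lemma thread_alt:
  assumes "finite U" "thread E U {} (zs @ [u])" "distinct (zs @ [u])" "set (zs @ [u]) \<subseteq> U"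
  shows "alt_count E U = 0 \<longleftrightarrow>
    alt_count E (if length zs mod 3 = 0 then U - set zs
           else if length zs mod 3 = 1 then U - set zs - insert u (nbrs E U u)
           else U - set zs - {u}) = 0"
  using assms
proof (induction "length zs" arbitrary: U zs rule: less_induct)
  case less
  consider "zs = []" | a where "zs = [a]" | a b where "zs = [a, b]" | a b c ws where "zs = a # b # c # ws"
    by (metis list.exhaust)
  then show ?case
  proof cases
    case 1
    then show ?thesis by simp
  next
    case (2 a)
    have "a \<in> nbrs E U u" using less.prems 2 by (auto intro: nbrs_sym)
    moreover have "alt_count E U = - alt_count E (U - insert u (nbrs E U u))"
      using less.prems 2 by (intro alt_leaf[of U a]) auto
    ultimately show ?thesis using 2 by (simp add: insert_absorb Diff_insert2[symmetric] insert_commute)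
  next
    case (3 a b)
    have "alt_count E U = - alt_count E (U - insert b (nbrs E U b))"
      using less.prems 3 by (intro alt_leaf[of U a]) auto
    moreover have "insert b (nbrs E U b) = {a, b, u}" using less.prems 3 by auto
    moreover have "U - {a, b, u} = U - set zs - {u}" using 3 by auto
    ultimately show ?thesis using 3 by simp
  next
    case (4 a b c ws)
    let ?X = "{a, b, c}"
    have "alt_count E U = - alt_count E (U - insert b (nbrs E U b))"
      using less.prems 4 by (intro alt_leaf[of U a]) auto
    moreover have "insert b (nbrs E U b) = ?X" using less.prems 4 by auto
    ultimately have eq: "alt_count E U = 0 \<longleftrightarrow> alt_count E (U - ?X) = 0" by simp
    obtain d ds where d: "ws @ [u] = d # ds" by (cases ws) auto
    \<comment> \<open>The only predecessor of the rest is \<open>c\<close>, which is among the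
      deleted vertices, so the rest again starts at a free end.\<close>
    have "thread E U {c} (ws @ [u])" using less.prems(2) 4 d by auto
    then have "thread E (U - ?X) ({c} - ?X) (ws @ [u])"
      by (rule thread_Diff) (use less.prems 4 in auto)
    then have th: "thread E (U - ?X) {} (ws @ [u])" by simp
    have IH: "alt_count E (U - ?X) = 0 \<longleftrightarrow>
      alt_count E (if length ws mod 3 = 0 then U - ?X - set ws
           else if length ws mod 3 = 1 then U - ?X - set ws - insert u (nbrs E (U - ?X) u)
           else U - ?X - set ws - {u}) = 0"
      by (rule less.hyps) (use less.prems 4 th in auto)
    have "length zs mod 3 = length ws mod 3" using 4 by (simp add: mod_add_self2[of "length ws" 3, symmetric] del: mod_add_self2)
    moreover have "U - ?X - set ws - insert u (nbrs E (U - ?X) u) = U - set zs - insert u (nbrs E U u)"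
      and "U - ?X - set ws - {u} = U - set zs - {u}" and "U - ?X - set ws = U - set zs"
      using 4 by (auto simp: nbrs_Diff)
    ultimately show ?thesis using eq IH by (simp only:)
  qed
qed

text \<open>The last vertex plays the root in \<open>thread_alt\<close>. If the number of the other
  vertices is divisible by 3, it ends up isolated and the count vanishes; in the other two cases the
  leaf rule consumes the whole component.\<close>

lemma path_component_alt:
  assumes "finite U" "thread E U {} zs" "distinct zs" "set zs \<subseteq> U"
    and closed: "zs \<noteq> [] \<Longrightarrow> nbrs E U (last zs) \<subseteq> set zs"
  shows "alt_count E U = 0 \<longleftrightarrow> length zs mod 3 = 1 \<or> alt_count E (U - set zs) = 0"
proof (cases zs rule: rev_cases)
  case Nil
  then show ?thesis by simp
next
  case (snoc ys u)
  have *: "alt_count E U = 0 \<longleftrightarrow>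
    alt_count E (if length ys mod 3 = 0 then U - set ys
           else if length ys mod 3 = 1 then U - set ys - insert u (nbrs E U u)
           else U - set ys - {u}) = 0"
    by (rule thread_alt) (use assms snoc in auto)
  have eq: "U - set ys - insert u (nbrs E U u) = U - set zs" "U - set ys - {u} = U - set zs"
    using closed snoc by auto
  show ?thesis
  proof (cases "length ys mod 3 = 0")
    case True
    have "alt_count E (U - set ys) = 0"
      by (rule alt_isolated[where v = u])
        (use assms snoc nbrs_irrefl[of u U] in \<open>auto simp: nbrs_Diff\<close>)
    then show ?thesis using * True snoc by (simp add: mod_Suc)
  next
    case False
    then show ?thesis using * eq snoc by (auto simp: mod_Suc split: if_splits)
  qed
qed

text \<open>Deleting the root \<open>v\<close> together with other vertices outside the branch turns
  the branch into a path component.\<close>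

lemma cut_thread_alt:
  assumes "finite U" "thread E U {} (zs @ [v])" "distinct zs" "set zs \<subseteq> U" "v \<in> X" "X \<inter> set zs = {}"
  shows "alt_count E (U - X) = 0 \<longleftrightarrow> length zs mod 3 = 1 \<or> alt_count E (U - X - set zs) = 0"
proof (rule path_component_alt)
  show "thread E (U - X) {} zs"
    using thread_Diff[OF thread_appendD[OF assms(2)] assms(6)] by simp
  show "nbrs E (U - X) (last zs) \<subseteq> set zs" if "zs \<noteq> []"
    using thread_nbrs[OF assms(2), of "last zs"] that assms(5) by (auto simp: nbrs_Diff)
qed (use assms in auto)

text \<open>The type 2 branch takes the root away with it. The other branch is then a component
  whose number of vertices is 1 modulo 3.\<close>

lemma pendants_1_2_alt:
  assumes "finite U" "pendant E U ys u" "pendant E U ys' u" "set ys \<inter> set ys' = {}"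
    and "length ys mod 3 = 1" "length ys' mod 3 = 2"
  shows "alt_count E U = 0"
proof -
  have "alt_count E U = 0 \<longleftrightarrow> alt_count E (U - set ys' - {u}) = 0"
    using thread_alt[of U ys' u] assms by (simp add: pendant_def)
  moreover have "alt_count E (U - insert u (set ys')) = 0"
    using cut_thread_alt[of U ys u "insert u (set ys')"] assms by (auto simp: pendant_def)
  ultimately show ?thesis by (simp add: Diff_insert[symmetric])
qed

text \<open>Type 0 is \<open>thread_alt\<close> for \<open>ys\<close> itself. Otherwise the
  remaining branch \<open>ys'\<close> dictates the same deletion with and without \<open>ys\<close>,
  and the results differ by a path component: \<open>ys\<close> without the vertex next to the root
  for type 1, all of \<open>ys\<close> for type 2. Its number of vertices is 0 or 2 modulo 3, so
  dropping it does not affect vanishing.\<close>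

lemma same_type_pendants_alt:
  assumes fin: "finite U" and ys: "pendant E U ys u" and ys': "pendant E U ys' u"
    and disj: "set ys \<inter> set ys' = {}" and type: "length ys mod 3 = length ys' mod 3"
  shows "alt_count E U = 0 \<longleftrightarrow> alt_count E (U - set ys) = 0"
proof -
  have u: "u \<notin> set ys" using ys by (simp add: pendant_def)
  have p': "pendant E (U - set ys) ys' u"
    using ys' disj u by (intro pendant_Diff) auto
  have alt': "alt_count E V = 0 \<longleftrightarrow>
    alt_count E (if length ys' mod 3 = 0 then V - set ys'
           else if length ys' mod 3 = 1 then V - set ys' - insert u (nbrs E V u)
           else V - set ys' - {u}) = 0" if "V = U \<or> V = U - set ys" for V
    by (rule thread_alt) (use that fin ys' p' in \<open>auto simp: pendant_def\<close>)
  consider "length ys mod 3 = 0" | "length ys mod 3 = 1" | "length ys mod 3 = 2" by linarith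
  then show ?thesis
  proof cases
    case 1
    then show ?thesis using thread_alt[of U ys u] fin ys by (simp add: pendant_def)
  next
    case 2
    obtain ws v where v: "ys = ws @ [v]"
      using ys by (cases ys rule: rev_cases) (auto simp: pendant_def)
    let ?X = "set ys' \<union> insert u (nbrs E U u)"
    have th: "thread E U {} (ws @ [v] @ [u])" using ys v by (simp add: pendant_def)
    have "thread E U {} (ws @ [v])" using thread_appendD[of E U "{}" "ws @ [v]" "[u]"] th by simp
    moreover have "v \<in> nbrs E U u"
      using thread_successively[OF th] ys v by (auto simp: pendant_def successively_append_iff intro: nbrs_sym)
    moreover have "nbrs E U u \<inter> set ws = {}"
    proof -
      have "x = v" if "x \<in> set ys" "x \<in> nbrs E U u" for x
        using thread_nbrs_last[of E U "{}" ys u x] ys v that nbrs_sym[of u U x] by (auto simp: pendant_def)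
      then show ?thesis using v ys by (auto simp: pendant_def)
    qed
    ultimately have "alt_count E (U - ?X) = 0 \<longleftrightarrow> length ws mod 3 = 1 \<or> alt_count E (U - ?X - set ws) = 0"
      by (intro cut_thread_alt) (use fin ys v disj in \<open>auto simp: pendant_def\<close>)
    moreover have "length ws mod 3 \<noteq> 1" using 2 v by (auto simp: mod_Suc split: if_splits)
    moreover have "U - ?X - set ws = U - set ys - set ys' - insert u (nbrs E (U - set ys) u)"
      using v \<open>v \<in> nbrs E U u\<close> by (auto simp: nbrs_Diff)
    moreover have "U - ?X = U - set ys' - insert u (nbrs E U u)" by auto
    ultimately show ?thesis using alt'[of U] alt'[of "U - set ys"] 2 type by simp
  next
    case 3
    let ?X = "insert u (set ys')"
    have "alt_count E (U - ?X) = 0 \<longleftrightarrow> length ys mod 3 = 1 \<or> alt_count E (U - ?X - set ys) = 0"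
      by (rule cut_thread_alt[of _ _ u]) (use fin ys disj in \<open>auto simp: pendant_def\<close>)
    moreover have "U - ?X - set ys = U - set ys - set ys' - {u}" "U - ?X = U - set ys' - {u}" by auto
    ultimately show ?thesis using alt'[of U] alt'[of "U - set ys"] 3 type by simp
  qed
qed

text \<open>The leaf of \<open>ys'\<close> is not in \<open>ys\<close>: all vertices of
  \<open>ys\<close> after the first have degree 2, and a common leaf would make the branches equal.
  A walk along \<open>ys'\<close> from there could enter \<open>ys\<close> only through
  \<open>u\<close>, which it avoids.\<close>

lemma pendant_disjoint:
  assumes ys: "pendant E U ys u" and ys': "pendant E U ys' u" and "ys \<noteq> ys'"
  shows "set ys \<inter> set ys' = {}"
proof -
  have hd_card: "card (nbrs E U (hd zs)) = 1" if zs: "pendant E U zs u" for zs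
  proof -
    obtain z zs' where z: "zs = z # zs'" using zs by (cases zs) (auto simp: pendant_def)
    have "nbrs E U z = {hd (zs' @ [u])}" using zs z by (cases zs') (auto simp: pendant_def)
    then show ?thesis by (simp add: z)
  qed
  have nbrs_ys: "nbrs E U x \<subseteq> insert u (set ys)" if "x \<in> set ys" for x
    using thread_nbrs[of E U "{}" ys u x] ys that by (auto simp: pendant_def)
  have hd_notin: "hd ys' \<notin> set ys"
  proof
    assume hd': "hd ys' \<in> set ys"
    obtain z zs where z: "ys = z # zs" using ys by (cases ys) (auto simp: pendant_def)
    have "thread E U {z} (zs @ [u])" using ys z by (cases zs) (auto simp: pendant_def)
    then have "card (nbrs E U x) = 2" if "x \<in> set zs" for x
      using thread_card_nbrs_eq[of E U "{z}" zs u x] that ys z by (auto simp: pendant_def)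
    then have "hd ys' = z" using hd' z hd_card[OF ys'] by fastforce
    then have "hd (ys @ [u]) = hd (ys' @ [u])" using z ys' by (auto simp: pendant_def)
    then have "ys = ys'"
      using ys ys' by (intro thread_unique[of E U "{}" ys u ys']) (auto simp: pendant_def)
    with assms show False by simp
  qed
  \<comment> \<open>Stated for arbitrary walks that avoid \<open>u\<close>, so that the induction
    can pass to tails.\<close>
  have "set zs \<inter> set ys = {}"
    if "successively (\<lambda>x y. y \<in> nbrs E U x) zs" "set zs \<subseteq> U - {u}" "zs \<noteq> [] \<Longrightarrow> hd zs \<notin> set ys" for zs
    using that
  proof (induction zs)
    case (Cons z zs)
    have "hd zs \<notin> set ys" if "zs \<noteq> []"
    proof
      assume "hd zs \<in> set ys"
      moreover have "hd zs \<in> nbrs E U z" using Cons.prems(1) that by (cases zs) auto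
      then have "z \<in> nbrs E U (hd zs)" using Cons.prems(2) by (auto intro: nbrs_sym)
      ultimately show False using nbrs_ys Cons.prems(2,3) by fastforce
    qed
    then have "set zs \<inter> set ys = {}"
      using Cons.IH Cons.prems by (cases zs) auto
    then show ?case using Cons.prems(3) by auto
  qed simp
  moreover have "successively (\<lambda>x y. y \<in> nbrs E U x) ys'"
    using thread_successively[of E U "{}" "ys' @ [u]"] ys' by (auto simp: pendant_def successively_append_iff)
  ultimately show ?thesis using hd_notin ys' by (fastforce simp: pendant_def)
qed

text \<open>The branches in \<open>C\<close> go one at a time, with \<open>ys\<close> present
  throughout as the partner of the same type. Disjointness keeps the branches not yet removed
  intact.\<close>

lemma remove_same_type_pendants_alt:
  assumes "finite C" "finite U" "pendant E U ys u" "ys \<notin> C"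
    and "\<And>zs. zs \<in> C \<Longrightarrow> pendant E U zs u \<and> length zs mod 3 = length ys mod 3"
  shows "alt_count E U = 0 \<longleftrightarrow> alt_count E (U - \<Union>(set ` C)) = 0"
  using assms
proof (induction C rule: finite_induct)
  case (insert zs C)
  let ?X = "\<Union>(set ` C)"
  have "?X \<inter> set (xs @ [u]) = {}" if "xs \<in> {ys, zs}" for xs
  proof -
    have "set ws \<inter> set xs = {}" if "ws \<in> C" for ws
      using that \<open>xs \<in> {ys, zs}\<close> insert.hyps(2) insert.prems(2-4)
      by (intro pendant_disjoint[of U ws u xs]) auto
    moreover have "u \<notin> set ws" if "ws \<in> C" for ws
      using insert.prems(4)[of ws] that by (auto simp: pendant_def)
    ultimately show ?thesis by auto
  qed
  then have "pendant E (U - ?X) ys u" "pendant E (U - ?X) zs u"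
    using insert.prems by (blast intro: pendant_Diff)+
  moreover have "set zs \<inter> set ys = {}"
    using insert.prems by (intro pendant_disjoint[of U zs u ys]) auto
  ultimately have "alt_count E (U - ?X) = 0 \<longleftrightarrow> alt_count E (U - ?X - set zs) = 0"
    using insert.prems by (intro same_type_pendants_alt[of _ _ u ys]) auto
  moreover have "U - ?X - set zs = U - \<Union>(set ` insert zs C)" by auto
  ultimately show ?case using insert by simp
qed simp

end

section \<open>The independence complex of a forest\<close>

text \<open>This is 1-degeneracy, which for finite graphs is acyclicity. In this form it passes to
  subsets at once and supplies vertices of low degree directly.\<close>

definition forest_on :: "('a \<Rightarrow> 'a \<Rightarrow> bool) \<Rightarrow> 'a set \<Rightarrow> bool" where
  "forest_on E U \<longleftrightarrow> (\<forall>W \<subseteq> U. W \<noteq> {} \<longrightarrow> (\<exists>w\<in>W. card (nbrs E W w) \<le> 1))"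

lemma forest_on_subset: "forest_on E U \<Longrightarrow> W \<subseteq> U \<Longrightarrow> forest_on E W"
  unfolding forest_on_def by (meson subset_trans)

context simple_graph
begin

abbreviation ind_complex :: "'a set \<Rightarrow> ('a \<Rightarrow> real) topology" where
  "ind_complex U \<equiv> geometric_realization (indep_sets E U)"

text \<open>An independence complex is a flag complex, so lying in a face becomes a condition on
  pairs of coordinates. The sum runs over the fixed set \<open>U\<close> instead of the varying
  support, ready for linear computations.\<close>

lemma topspace_complex:
  assumes "finite U"
  shows "topspace (ind_complex U) =
    {x. (\<forall>v. 0 \<le> x v) \<and> (\<forall>v. v \<notin> U \<longrightarrow> x v = 0) \<and> (\<Sum>v\<in>U. x v) = 1 \<and>
        (\<forall>u v. E u v \<longrightarrow> x u = 0 \<or> x v = 0)}"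
proof -
  have "{v. x v \<noteq> 0} \<in> indep_sets E U \<longleftrightarrow>
      (\<forall>v. v \<notin> U \<longrightarrow> x v = 0) \<and> (\<forall>u v. E u v \<longrightarrow> x u = 0 \<or> x v = 0)" for x :: "'a \<Rightarrow> real"
    unfolding indep_sets_def pairwise_def using adj_irrefl by (simp add: subset_iff) metis
  moreover have "(\<Sum>v | x v \<noteq> 0. x v) = (\<Sum>v\<in>U. x v)" if "\<forall>v. v \<notin> U \<longrightarrow> x v = 0" for x :: "'a \<Rightarrow> real"
    using that assms by (intro sum.mono_neutral_left) auto
  ultimately show ?thesis
    by (auto simp: geometric_realization_def)
qed

lemma complex_eq: "ind_complex U = subtopology (powertop_real UNIV) (topspace (ind_complex U))"
  by (simp add: geometric_realization_def)

lemma continuous_map_complex_proj: "continuous_map (ind_complex U) euclideanreal (\<lambda>x. x v)"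
  unfolding geometric_realization_def
  by (rule continuous_map_from_subtopology, rule continuous_map_product_projection) simp

lemma continuous_map_into_complex:
  assumes "\<And>v. continuous_map X euclideanreal (\<lambda>x. f x v)"
    and "\<And>x. x \<in> topspace X \<Longrightarrow> f x \<in> topspace (ind_complex U)"
  shows "continuous_map X (ind_complex U) f"
  by (subst complex_eq)
    (use assms in \<open>auto simp: continuous_map_in_subtopology continuous_map_componentwise_UNIV\<close>)

text \<open>By \<open>carrier\<close> the supports of \<open>x\<close> and \<open>f x\<close>
  together form an independent set, so the segment between the two points stays in one
  simplex.\<close>

lemma straight_line_homotopy:
  assumes fin: "finite U" and f: "continuous_map (ind_complex U) (ind_complex U) f"
    and carrier: "\<And>x u v. x \<in> topspace (ind_complex U) \<Longrightarrow> E u v \<Longrightarrow> x u = 0 \<and> f x u = 0 \<or> x v = 0 \<and> f x v = 0"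
  shows "homotopic_with (\<lambda>_. True) (ind_complex U) (ind_complex U) id f"
proof -
  define h :: "real \<times> ('a \<Rightarrow> real) \<Rightarrow> 'a \<Rightarrow> real" where
    "h = (\<lambda>(t, x) v. (1 - t) * x v + t * f x v)"
  let ?X = "prod_topology (top_of_set {0..1::real}) (ind_complex U)"
  have "continuous_map ?X (ind_complex U) h"
  proof (rule continuous_map_into_complex)
    fix v
    have t: "continuous_map ?X euclideanreal fst"
      by (rule continuous_map_into_fulltopology[OF continuous_map_fst])
    have x: "continuous_map ?X euclideanreal (\<lambda>z. snd z v)"
      using continuous_map_compose[OF continuous_map_snd continuous_map_complex_proj] by (simp add: o_def)
    have "continuous_map (ind_complex U) euclideanreal (\<lambda>x. f x v)"
      using continuous_map_compose[OF f continuous_map_complex_proj] by (simp add: o_def)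
    then have fx: "continuous_map ?X euclideanreal (\<lambda>z. f (snd z) v)"
      using continuous_map_compose[OF continuous_map_snd] by (fastforce simp: o_def)
    show "continuous_map ?X euclideanreal (\<lambda>z. h z v)"
      unfolding h_def case_prod_unfold by (intro continuous_intros t x fx) auto
  next
    fix z assume z: "z \<in> topspace ?X"
    obtain t x where tx: "z = (t, x)" by (cases z)
    have t: "0 \<le> t" "t \<le> 1" and x: "x \<in> topspace (ind_complex U)" using z tx by auto
    have fx: "f x \<in> topspace (ind_complex U)"
      using f x by (auto simp: continuous_map_def)
    have "(\<Sum>v\<in>U. (1 - t) * x v + t * f x v) = 1"
      using x fx by (simp add: topspace_complex[OF fin] sum.distrib sum_distrib_left[symmetric])
    moreover have "0 \<le> (1 - t) * x v + t * f x v" for v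
      using t x fx by (simp add: topspace_complex[OF fin])
    moreover have "(1 - t) * x u + t * f x u = 0 \<or> (1 - t) * x v + t * f x v = 0" if "E u v" for u v
      using carrier[OF x that] by auto
    moreover have "(1 - t) * x v + t * f x v = 0" if "v \<notin> U" for v
      using x fx that by (simp add: topspace_complex[OF fin])
    ultimately show "h z \<in> topspace (ind_complex U)"
      unfolding topspace_complex[OF fin] h_def tx by simp
  qed
  then show ?thesis
    unfolding homotopic_with_def by (intro exI[of _ h]) (auto simp: h_def)
qed

lemma contractible_isolated:
  assumes fin: "finite U" and a: "a \<in> U" "nbrs E U a = {}"
  shows "contractible_space (ind_complex U)"
proof -
  \<comment> \<open>The apex of the cone, as a point in barycentric coordinates.\<close>
  define p :: "'a \<Rightarrow> real" where "p = (\<lambda>v. if v = a then 1 else 0)"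
  have "p \<in> topspace (ind_complex U)"
    using a fin by (auto simp: topspace_complex[OF fin] p_def adj_irrefl)
  then have "continuous_map (ind_complex U) (ind_complex U) (\<lambda>_. p)"
    by (simp add: continuous_map_const)
  then have "homotopic_with (\<lambda>_. True) (ind_complex U) (ind_complex U) id (\<lambda>_. p)"
  proof (rule straight_line_homotopy[OF fin])
    fix x u v assume x: "x \<in> topspace (ind_complex U)" and "E u v"
    then have "x u = 0 \<or> x v = 0" by (auto simp: topspace_complex[OF fin])
    \<comment> \<open>\<open>E\<close> also relates vertices outside \<open>U\<close>. An edge at
      \<open>a\<close> has its other end there, where both \<open>x\<close> and \<open>p\<close>
      vanish; at any other edge \<open>p\<close> vanishes on both ends.\<close>
    moreover have "u \<noteq> v" "u = a \<Longrightarrow> v \<notin> U" "v = a \<Longrightarrow> u \<notin> U"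
      using \<open>E u v\<close> a adj_irrefl adj_sym by (auto simp: nbrs_def)
    ultimately show "x u = 0 \<and> p u = 0 \<or> x v = 0 \<and> p v = 0"
      using x by (auto simp: topspace_complex[OF fin] p_def)
  qed
  then show ?thesis by (auto simp: contractible_space_def)
qed

text \<open>The mass of \<open>b\<close> is moved to \<open>a\<close>.\<close>

lemma contractible_fold:
  assumes fin: "finite U" and ab: "a \<in> U" "b \<in> U" "a \<noteq> b" and sub: "nbrs E U a \<subseteq> nbrs E U b"
  shows "contractible_space (ind_complex U) \<longleftrightarrow> contractible_space (ind_complex (U - {b}))"
proof (rule homotopy_equivalent_space_contractibility, rule deformation_retract_imp_homotopy_equivalent_space)
  define r :: "('a \<Rightarrow> real) \<Rightarrow> 'a \<Rightarrow> real" where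
    "r = (\<lambda>x v. if v = a then x a + x b else if v = b then 0 else x v)"
  have fin': "finite (U - {b})" using fin by simp
  have sub': "topspace (ind_complex (U - {b})) \<subseteq> topspace (ind_complex U)"
    using ab by (auto simp: topspace_complex[OF fin] topspace_complex[OF fin'] sum.remove[OF fin ab(2)])
  have nbr: "E b v" if "E a v" "v \<in> U" for v using sub that by (auto simp: nbrs_def)
  have carrier: "x u = 0 \<and> r x u = 0 \<or> x v = 0 \<and> r x v = 0"
    if x: "x \<in> topspace (ind_complex U)" and "E u v" for x u v
  proof -
    have indep: "x u = 0 \<or> x v = 0" if "E u v" for u v
      using x that by (auto simp: topspace_complex[OF fin])
    have out: "x v = 0" if "v \<notin> U" for v using x that by (auto simp: topspace_complex[OF fin])
    \<comment> \<open>Only at \<open>a\<close> can \<open>r\<close> raise a coordinate. A neighbour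
      \<open>v\<close> of \<open>a\<close> in \<open>U\<close> is also a neighbour of
      \<open>b\<close>, so mass at \<open>v\<close> excludes mass at both.\<close>
    have *: "x v = 0 \<and> r x v = 0 \<or> x a = 0 \<and> r x a = 0" if "E a v" for v
    proof -
      have "v \<noteq> a" "v \<noteq> b" using that ab nbr[of b] adj_irrefl by auto
      moreover have "x v = 0 \<or> x a = 0" "x v = 0 \<or> x b = 0"
        using indep[OF that] indep[of b v] nbr[of v] out[of v] that by blast+
      ultimately show ?thesis by (auto simp: r_def)
    qed
    show ?thesis
      using *[of v] *[of u] indep[OF \<open>E u v\<close>] \<open>E u v\<close> adj_sym[OF \<open>E u v\<close>] by (auto simp: r_def)
  qed
  have cont: "continuous_map (ind_complex U) euclideanreal (\<lambda>x. r x v)" for v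
    unfolding r_def by (cases "v = a"; cases "v = b") (auto intro!: continuous_intros continuous_map_complex_proj)
  have mem: "r x \<in> topspace (ind_complex (U - {b}))" if x: "x \<in> topspace (ind_complex U)" for x
  proof -
    have "(\<Sum>v\<in>U - {b}. r x v) = r x a + (\<Sum>v\<in>U - {b} - {a}. r x v)"
      using fin' ab by (intro sum.remove) auto
    also have "(\<Sum>v\<in>U - {b} - {a}. r x v) = (\<Sum>v\<in>U - {b} - {a}. x v)"
      by (intro sum.cong) (auto simp: r_def)
    also have "r x a + \<dots> = (\<Sum>v\<in>U. x v)"
      using fin fin' ab by (simp add: sum.remove[OF fin ab(2)] sum.remove[OF fin', of a] r_def)
    finally have "(\<Sum>v\<in>U - {b}. r x v) = 1" using x by (simp add: topspace_complex[OF fin])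
    moreover have "r x u = 0 \<or> r x v = 0" if "E u v" for u v using carrier[OF x that] by auto
    moreover have "0 \<le> r x v" for v using x by (simp add: topspace_complex[OF fin] r_def)
    moreover have "r x v = 0" if "v \<notin> U - {b}" for v
    proof (cases "v = b")
      case True
      then show ?thesis using ab by (simp add: r_def)
    next
      case False
      then have "v \<noteq> a" "x v = 0" using x ab that by (auto simp: topspace_complex[OF fin])
      then show ?thesis by (simp add: r_def)
    qed
    ultimately show ?thesis unfolding topspace_complex[OF fin'] by blast
  qed
  show "retraction_maps (ind_complex U) (ind_complex (U - {b})) r id"
    unfolding retraction_maps_def
  proof (intro conjI ballI)
    show "continuous_map (ind_complex U) (ind_complex (U - {b})) r"
      by (rule continuous_map_into_complex[OF cont mem])
    show "continuous_map (ind_complex (U - {b})) (ind_complex U) id"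
      by (rule continuous_map_into_complex)
        (use sub' in \<open>auto simp: continuous_map_complex_proj\<close>)
    show "r (id x) = x" if "x \<in> topspace (ind_complex (U - {b}))" for x
      using that by (auto simp: topspace_complex[OF fin'] r_def fun_eq_iff)
  qed
  have "homotopic_with (\<lambda>_. True) (ind_complex U) (ind_complex U) id r"
    by (rule straight_line_homotopy[OF fin continuous_map_into_complex[OF cont]])
      (use mem sub' carrier in auto)
  then show "homotopic_with (\<lambda>x. True) (ind_complex U) (ind_complex U) r id"
    by (simp add: homotopic_with_sym)
qed

text \<open>
  The complex is the boundary of a cross-polytope.  Taking \<open>A\<close> to contain one end of every edge, the
  sphere embeds by splitting a coordinate into its positive and negative parts, placed on the
  two ends of the edge; \<open>k\<close> is a left inverse of this embedding \<open>f\<close>.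
\<close>

lemma not_contractible_matching:
  assumes fin: "finite U" and "U \<noteq> {}" and "\<And>v. v \<in> U \<Longrightarrow> card (nbrs E U v) = 1"
  shows "\<not> contractible_space (ind_complex U)"
proof -
  have "\<forall>v\<in>U. \<exists>w. nbrs E U v = {w}" using assms(3) by (meson card_1_singletonE)
  then obtain m where nbrs_m: "\<And>v. v \<in> U \<Longrightarrow> nbrs E U v = {m v}" by metis
  have m: "m v \<in> U" "m (m v) = v" "E v (m v)" "m v \<noteq> v" if "v \<in> U" for v
  proof -
    have "m v \<in> nbrs E U v" using nbrs_m[OF that] by simp
    then show *: "m v \<in> U" "E v (m v)" "m v \<noteq> v" by (auto simp: nbrs_def adj_irrefl)
    have "v \<in> nbrs E U (m v)" using * that by (simp add: nbrs_def adj_sym)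
    then show "m (m v) = v" using nbrs_m[OF *(1)] by simp
  qed
  have m_unique: "w = m v" if "E v w" "v \<in> U" "w \<in> U" for v w
    using nbrs_m[OF that(2)] that by (auto simp: nbrs_def)
  obtain idx :: "'a \<Rightarrow> nat" where idx: "inj_on idx U"
    using finite_imp_inj_to_nat_seg[OF fin] by blast
  \<comment> \<open>The numbering \<open>idx\<close> only serves to choose one end of each edge;
    \<open>m\<close> exchanges \<open>A\<close> with its complement in \<open>U\<close>.\<close>
  define A where "A = {v \<in> U. idx v < idx (m v)}"
  have A_iff: "m v \<in> A \<longleftrightarrow> v \<notin> A" if "v \<in> U" for v
  proof -
    have "idx v \<noteq> idx (m v)" using idx m[OF that] that by (auto dest: inj_onD)
    then show ?thesis using m[OF that] that by (auto simp: A_def)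
  qed
  have AU: "A \<subseteq> U" by (auto simp: A_def)
  have finA: "finite A" using AU fin finite_subset by blast
  have "A \<noteq> {}" using \<open>U \<noteq> {}\<close> A_iff by blast
  then obtain n where n: "card A = Suc n" using finA by (metis card_eq_0_iff not0_implies_Suc)
  obtain h where h: "bij_betw h {..n} A"
    using ex_bij_betw_nat_finite[OF finA] n by (auto simp: atLeast0LessThan lessThan_Suc_atMost)
  define g where "g = inv_into {..n} h"
  have hA: "h i \<in> A" "g (h i) = i" if "i \<le> n" for i
    using h that by (auto simp: bij_betw_def g_def)
  have gA: "g v \<le> n" "h (g v) = v" if "v \<in> A" for v
    using h that by (auto simp: bij_betw_def g_def inv_into_into f_inv_into_f dest: inv_into_into)
  let ?S = "nsphere n"
  have sphere: "y \<in> topspace ?S \<longleftrightarrow> (\<Sum>i\<le>n. (y i)\<^sup>2) = 1 \<and> (\<forall>i>n. y i = 0)" for y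
    by (simp add: nsphere)
  \<comment> \<open>The sum norm, because barycentric coordinates add up to 1; \<open>k\<close>
    returns to the sphere by dividing by the Euclidean norm.\<close>
  define N where "N = (\<lambda>y :: nat \<Rightarrow> real. \<Sum>i\<le>n. \<bar>y i\<bar>)"
  define f :: "(nat \<Rightarrow> real) \<Rightarrow> 'a \<Rightarrow> real" where
    "f = (\<lambda>y v. if v \<in> A then max (y (g v)) 0 / N y
              else if v \<in> U then max (- y (g (m v))) 0 / N y else 0)"
  \<comment> \<open>At most one end of an edge carries mass, so the difference recovers the signed
    coordinate up to scale.\<close>
  define d where "d = (\<lambda>(x :: 'a \<Rightarrow> real) i. x (h i) - x (m (h i)))"
  define k :: "('a \<Rightarrow> real) \<Rightarrow> nat \<Rightarrow> real" where
    "k = (\<lambda>x i. if i \<le> n then d x i / sqrt (\<Sum>j\<le>n. (d x j)\<^sup>2) else 0)"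
  have N_pos: "N y > 0" if "y \<in> topspace ?S" for y
  proof -
    have "\<exists>i\<le>n. y i \<noteq> 0"
    proof (rule ccontr)
      assume "\<not> ?thesis"
      then have "(\<Sum>i\<le>n. (y i)\<^sup>2) = 0" by simp
      with that show False by (simp add: sphere)
    qed
    then show ?thesis unfolding N_def by (auto intro!: sum_pos2)
  qed
  \<comment> \<open>\<open>k\<close> divides by this on the whole complex, not just on the image of
    \<open>f\<close>. Where some vertex has mass its partner has none, hence some difference is
    nonzero.\<close>
  have d_pos: "(\<Sum>j\<le>n. (d x j)\<^sup>2) > 0" if x: "x \<in> topspace (ind_complex U)" for x
  proof -
    have "\<exists>v\<in>U. x v \<noteq> 0"
    proof (rule ccontr)
      assume "\<not> ?thesis"
      then have "(\<Sum>v\<in>U. x v) = 0" by simp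
      with x show False by (simp add: topspace_complex[OF fin])
    qed
    then obtain v where v: "v \<in> U" "x v \<noteq> 0" by blast
    have "x (m v) = 0" using x m(3)[OF v(1)] v(2) by (auto simp: topspace_complex[OF fin])
    then have "\<exists>w\<in>A. x w - x (m w) \<noteq> 0"
      using v m(1,2)[OF v(1)] A_iff[OF v(1)]
      by (cases "v \<in> A") (auto intro: bexI[of _ v] bexI[of _ "m v"])
    then obtain w where w: "w \<in> A" "x w - x (m w) \<noteq> 0" by blast
    then have "d x (g w) \<noteq> 0" using gA(2)[OF w(1)] by (simp add: d_def)
    then show ?thesis using gA(1)[OF w(1)] by (intro sum_pos2[of _ "g w"]) auto
  qed
  have f_mem: "f y \<in> topspace (ind_complex U)" if y: "y \<in> topspace ?S" for y
  proof -
    have "(\<Sum>v\<in>U. f y v) = (\<Sum>v\<in>A. f y v) + (\<Sum>v\<in>U - A. f y v)"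
      using fin AU by (simp add: sum.subset_diff add.commute)
    also have "(\<Sum>v\<in>U - A. f y v) = (\<Sum>v\<in>A. f y (m v))"
      by (rule sum.reindex_bij_witness[of _ m m]) (use AU A_iff m in auto)
    also have "(\<Sum>v\<in>A. f y v) + \<dots> = (\<Sum>v\<in>A. \<bar>y (g v)\<bar> / N y)"
      unfolding sum.distrib[symmetric]
    proof (rule sum.cong)
      fix v assume "v \<in> A"
      then have "m v \<notin> A" "m v \<in> U" "m (m v) = v" using AU A_iff m by auto
      then show "f y v + f y (m v) = \<bar>y (g v)\<bar> / N y"
        using \<open>v \<in> A\<close> by (simp add: f_def max_def abs_if)
    qed simp
    also have "\<dots> = (\<Sum>i\<le>n. \<bar>y i\<bar> / N y)"
      by (rule sum.reindex_bij_witness[of _ h g]) (use hA gA in auto)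
    also have "\<dots> = 1"
      using N_pos[OF y] by (simp add: sum_divide_distrib[symmetric] N_def)
    finally have "(\<Sum>v\<in>U. f y v) = 1" .
    moreover have "0 \<le> f y v" for v using N_pos[OF y] by (simp add: f_def)
    moreover have "f y v = 0" if "v \<notin> U" for v using that AU by (auto simp: f_def)
    moreover have "f y u = 0 \<or> f y v = 0" if "E u v" for u v
    proof (cases "u \<in> U \<and> v \<in> U")
      case True
      then have "v = m u" "u = m v" using m_unique that adj_sym by blast+
      then show ?thesis using True A_iff by (auto simp: f_def max_def)
    next
      case False
      then show ?thesis using AU by (auto simp: f_def)
    qed
    ultimately show ?thesis unfolding topspace_complex[OF fin] by blast
  qed
  have proj: "continuous_map ?S euclideanreal (\<lambda>y. y i)" for i
    by (rule continuous_map_nsphere_projection)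
  have N_cont: "continuous_map ?S euclideanreal N"
    unfolding N_def by (intro continuous_intros proj) auto
  have f_cont: "continuous_map ?S (ind_complex U) f"
  proof (rule continuous_map_into_complex[OF _ f_mem])
    fix v
    have N0: "N y \<noteq> 0" if "y \<in> topspace ?S" for y using N_pos[OF that] by simp
    show "continuous_map ?S euclideanreal (\<lambda>y. f y v)"
      unfolding f_def
      by (cases "v \<in> A"; cases "v \<in> U")
        (auto intro!: continuous_map_real_divide continuous_map_real_max continuous_map_minus proj N_cont N0)
  qed
  have d_cont: "continuous_map (ind_complex U) euclideanreal (\<lambda>x. d x i)" for i
    unfolding d_def by (intro continuous_intros continuous_map_complex_proj)
  have k_cont: "continuous_map (ind_complex U) ?S k"
    unfolding nsphere continuous_map_in_subtopology continuous_map_componentwise_UNIV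
  proof (intro conjI allI)
    fix i
    have "sqrt (\<Sum>j\<le>n. (d x j)\<^sup>2) \<noteq> 0" if "x \<in> topspace (ind_complex U)" for x
      using d_pos[OF that] by simp
    then show "continuous_map (ind_complex U) euclideanreal (\<lambda>x. k x i)"
      unfolding k_def
      by (cases "i \<le> n") (auto intro!: continuous_map_real_divide continuous_intros d_cont)
    show "k \<in> topspace (ind_complex U) \<rightarrow> {x. (\<Sum>i\<le>n. (x i)\<^sup>2) = 1 \<and> (\<forall>i>n. x i = 0)}"
    proof (intro Pi_I CollectI conjI)
      fix x assume x: "x \<in> topspace (ind_complex U)"
      have "(\<Sum>i\<le>n. (k x i)\<^sup>2) = (\<Sum>i\<le>n. (d x i)\<^sup>2 / (\<Sum>j\<le>n. (d x j)\<^sup>2))"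
        using d_pos[OF x] by (intro sum.cong) (auto simp: k_def power_divide)
      also have "\<dots> = 1" using d_pos[OF x] by (simp add: sum_divide_distrib[symmetric])
      finally show "(\<Sum>i\<le>n. (k x i)\<^sup>2) = 1" .
    qed (simp add: k_def)
  qed
  have kf: "k (f y) = y" if y: "y \<in> topspace ?S" for y
  proof -
    have d: "d (f y) i = y i / N y" if "i \<le> n" for i
    proof -
      have "m (h i) \<notin> A" "m (h i) \<in> U" "m (m (h i)) = h i"
        using hA[OF that] AU A_iff m by auto
      then show ?thesis using hA[OF that] by (simp add: d_def f_def max_def diff_divide_distrib)
    qed
    have "(\<Sum>j\<le>n. (d (f y) j)\<^sup>2) = (\<Sum>j\<le>n. (y j)\<^sup>2) / (N y)\<^sup>2"
      by (simp add: d power_divide sum_divide_distrib)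
    then have "sqrt (\<Sum>j\<le>n. (d (f y) j)\<^sup>2) = 1 / N y"
      using y N_pos[OF y] by (simp add: sphere real_sqrt_divide)
    then show ?thesis
      using d y N_pos[OF y] by (auto simp: k_def fun_eq_iff sphere)
  qed
  \<comment> \<open>The sphere is thus dominated by the complex, and contracting the complex would
    contract the sphere.\<close>
  have "homotopic_with (\<lambda>x. True) ?S ?S (k \<circ> f) id"
    by (rule homotopic_with_equal) (use f_cont k_cont kf in \<open>auto intro: continuous_map_compose\<close>)
  then show ?thesis
    using homotopy_dominated_contractibility[OF k_cont f_cont] non_contractible_space_nsphere by blast
qed

text \<open>Each use of the leaf rule removes one edge with both ends and flips the sign, down to
  the empty graph with count 1.\<close>

lemma alt_matching:
  assumes "finite U" "\<And>v. v \<in> U \<Longrightarrow> card (nbrs E U v) = 1"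
  shows "alt_count E U \<noteq> 0"
  using assms
proof (induction U rule: finite_psubset_induct)
  case (psubset U)
  show ?case
  proof (cases "U = {}")
    case True
    then have "indep_sets E U = {{}}" by (auto simp: indep_sets_def)
    then show ?thesis by (simp add: alt_count_def)
  next
    case False
    then obtain l where l: "l \<in> U" by blast
    then obtain w where w: "nbrs E U l = {w}" using psubset.prems by (meson card_1_singletonE)
    then have wU: "w \<in> U" by (auto simp: nbrs_def)
    have lw: "l \<in> nbrs E U w" using w l by (auto intro: nbrs_sym)
    then have w': "nbrs E U w = {l}" using psubset.prems[OF wU] by (auto simp: card_1_singleton_iff)
    let ?V = "U - insert w (nbrs E U w)"
    have "card (nbrs E ?V v) = 1" if v: "v \<in> ?V" for v
    proof -
      have "w \<notin> nbrs E U v" "l \<notin> nbrs E U v"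
        using v w w' nbrs_sym[of v U w] nbrs_sym[of v U l] by auto
      then have "nbrs E ?V v = nbrs E U v" using w' by (auto simp: nbrs_Diff)
      then show ?thesis using psubset.prems v by simp
    qed
    moreover have "?V \<subset> U" using wU by blast
    ultimately have "alt_count E ?V \<noteq> 0" using psubset.IH[of ?V] by blast
    then show ?thesis using alt_leaf[OF psubset.hyps(1) l w] by simp
  qed
qed

text \<open>The empty graph is excluded because its realization, the empty space, is contractible
  for \<open>contractible_space\<close>, while its count is 1. A fold preserves nonemptiness, as
  \<open>a\<close> remains.\<close>

lemma forest_contractible_iff:
  assumes "finite U" "forest_on E U" "U \<noteq> {}"
  shows "contractible_space (ind_complex U) \<longleftrightarrow> alt_count E U = 0"
  using assms
proof (induction U rule: finite_psubset_induct)
  case (psubset U)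
  note fin = psubset.hyps(1)
  consider (isolated) a where "a \<in> U" "nbrs E U a = {}"
    | (fold) a b where "a \<in> U" "b \<in> U" "a \<noteq> b" "nbrs E U a \<subseteq> nbrs E U b"
    | (rigid) "\<forall>a\<in>U. nbrs E U a \<noteq> {}" "\<forall>a\<in>U. \<forall>b\<in>U. nbrs E U a \<subseteq> nbrs E U b \<longrightarrow> a = b"
    by blast
  then show ?case
  proof cases
    case isolated
    then show ?thesis using contractible_isolated alt_isolated fin by blast
  next
    case fold
    have "U - {b} \<subset> U" "U - {b} \<noteq> {}" "forest_on E (U - {b})"
      using fold psubset.prems forest_on_subset[of E U "U - {b}"] by blast+
    then show ?thesis
      using contractible_fold[OF fin fold] alt_fold[OF fin fold] psubset.IH[of "U - {b}"] by simp
  next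
    case rigid
    \<comment> \<open>If some degree differs from 1, the forest property inside \<open>W\<close>
      gives \<open>w\<close> with at most one neighbour in \<open>W\<close> but at least two in
      \<open>U\<close>. So \<open>w\<close> has a neighbour \<open>l\<close> of degree 1 and a
      further neighbour \<open>x\<close>, and the neighbourhood of \<open>l\<close>, just
      \<open>w\<close>, lies in that of \<open>x\<close>, against rigidity.\<close>
    define W where "W = {v \<in> U. card (nbrs E U v) \<noteq> 1}"
    have "W = {}"
    proof (rule ccontr)
      assume "W \<noteq> {}"
      moreover have "W \<subseteq> U" by (auto simp: W_def)
      ultimately obtain w where w: "w \<in> W" "card (nbrs E W w) \<le> 1"
        using psubset.prems(1) unfolding forest_on_def by blast
      have wU: "w \<in> U" using w by (auto simp: W_def)
      have "card (nbrs E U w) \<noteq> 0"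
        using rigid(1) wU fin by (simp add: finite_nbrs)
      then have deg: "card (nbrs E U w) \<ge> 2" using w by (simp add: W_def)
      have "\<not> nbrs E U w \<subseteq> nbrs E W w"
      proof
        assume "nbrs E U w \<subseteq> nbrs E W w"
        then have "card (nbrs E U w) \<le> card (nbrs E W w)"
          by (intro card_mono finite_nbrs finite_subset[OF \<open>W \<subseteq> U\<close> fin])
        then show False using deg w(2) by simp
      qed
      then obtain l where l: "l \<in> nbrs E U w" "l \<notin> W" by (auto simp: nbrs_def W_def)
      have lU: "l \<in> U" using l by (auto simp: nbrs_def)
      have "card (nbrs E U l) = 1" using l lU by (auto simp: W_def)
      moreover have "w \<in> nbrs E U l" using l wU by (auto intro: nbrs_sym)
      ultimately have nl: "nbrs E U l = {w}" by (auto simp: card_1_singleton_iff)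
      have "\<exists>x\<in>nbrs E U w. x \<noteq> l"
      proof (rule ccontr)
        assume "\<not> ?thesis"
        then have "nbrs E U w \<subseteq> {l}" by blast
        then have "card (nbrs E U w) \<le> card {l}" by (intro card_mono) auto
        then show False using deg by simp
      qed
      then obtain x where x: "x \<in> nbrs E U w" "x \<noteq> l" by blast
      then have "x \<in> U" "w \<in> nbrs E U x" using wU by (auto simp: nbrs_def intro: adj_sym)
      then have "l = x" using rigid(2)[rule_format, OF lU, of x] nl by simp
      with x(2) show False by simp
    qed
    then have "card (nbrs E U v) = 1" if "v \<in> U" for v using that by (auto simp: W_def)
    then show ?thesis
      using not_contractible_matching[OF fin psubset.prems(2)] alt_matching[OF fin] by blast
  qed
qed

end

section \<open>Branches in a tree\<close>

text \<open>
  Connectedness in terms of cuts, so that deleting branches does not require rerouting walks.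
\<close>

definition connected_on :: "('a \<Rightarrow> 'a \<Rightarrow> bool) \<Rightarrow> 'a set \<Rightarrow> bool" where
  "connected_on E U \<longleftrightarrow> (\<forall>X \<subseteq> U. X \<noteq> {} \<longrightarrow> (\<forall>x\<in>X. nbrs E U x \<subseteq> X) \<longrightarrow> X = U)"

lemma connected_onD:
  "connected_on E U \<Longrightarrow> X \<subseteq> U \<Longrightarrow> X \<noteq> {} \<Longrightarrow> (\<And>x. x \<in> X \<Longrightarrow> nbrs E U x \<subseteq> X) \<Longrightarrow> X = U"
  by (simp add: connected_on_def)

lemma thread_iff_nth:
  "thread E U P zs \<longleftrightarrow>
   (\<forall>i. Suc i < length zs \<longrightarrow>
      nbrs E U (zs ! i) = insert (zs ! Suc i) (if i = 0 then P else {zs ! (i - 1)}))"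
proof (induction E U P zs rule: thread.induct)
  case (1 E U P z z' zs)
  have "(\<forall>i. Suc i < length (z # z' # zs) \<longrightarrow> Q i) \<longleftrightarrow>
    Q 0 \<and> (\<forall>i. Suc i < length (z' # zs) \<longrightarrow> Q (Suc i))" for Q
    by (auto simp: less_Suc_eq_0_disj all_conj_distrib)
  moreover have "(if i = 0 then {z} else {(z' # zs) ! (i - 1)}) = {(z # z' # zs) ! i}" for i
    by (cases i) auto
  ultimately show ?case using 1 by simp
qed auto

lemma thread_snoc:
  "thread E U P (ys @ [u]) \<Longrightarrow> nbrs E U u = insert y (if ys = [] then P else {last ys})
    \<Longrightarrow> thread E U P (ys @ [u, y])"
proof (induction ys arbitrary: P)
  case (Cons z ys)
  then show ?case by (cases ys) auto
qed simp

context simple_graph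
begin

text \<open>The known neighbours of a vertex, its successor and \<open>P\<close>, already exhaust
  the degree bound, so there are no others. The last vertex, a possible root, has no bound when the
  list has at least two vertices; the head has its own, in terms of \<open>P\<close>.\<close>

lemma threadI:
  assumes "finite U" "successively E zs" "distinct zs" "set zs \<subseteq> U" "P \<subseteq> U" "\<And>x. x \<in> P \<Longrightarrow> E (hd zs) x"
    and "P \<inter> set zs = {}" "card (nbrs E U (hd zs)) \<le> Suc (card P)"
    and "\<And>z. z \<in> set (tl (butlast zs)) \<Longrightarrow> card (nbrs E U z) \<le> 2"
  shows "thread E U P zs"
  using assms
proof (induction zs arbitrary: P)
  case (Cons z zs)
  show ?case
  proof (cases zs)
    case Nil
    then show ?thesis by simp
  next
    case zs: (Cons z' zs')
    have "insert z' P = nbrs E U z"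
    proof (rule card_seteq)
      show "finite (nbrs E U z)" by (rule finite_nbrs) fact
      show "insert z' P \<subseteq> nbrs E U z" using Cons.prems zs by (auto simp: nbrs_def)
      have "z' \<notin> P" "finite P"
        using Cons.prems(1,5,7) zs finite_subset by auto
      then show "card (nbrs E U z) \<le> card (insert z' P)" using Cons.prems(8) by simp
    qed
    moreover have "thread E U {z} zs"
    proof (cases "zs' = []")
      case False
      show ?thesis
      proof (rule Cons.IH)
        have z': "z' \<in> set (tl (butlast (z # zs)))" using zs False by simp
        show "card (nbrs E U (hd zs)) \<le> Suc (card {z})" using Cons.prems(9)[OF z'] zs by simp
        show "card (nbrs E U v) \<le> 2" if "v \<in> set (tl (butlast zs))" for v
          using that zs False by (intro Cons.prems(9)) (auto split: if_splits)
      qed (use Cons.prems zs in \<open>auto intro: adj_sym\<close>)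
    qed (simp add: zs)
    ultimately show ?thesis by (simp add: zs)
  qed
qed simp

text \<open>\<open>thread\<close> is silent about the last vertex, so adjacency is read off at the
  smaller index and transferred by symmetry.\<close>

lemma thread_adj:
  assumes "thread E U {} zs" "distinct zs" "set zs \<subseteq> U" "i < length zs" "j < length zs"
  shows "E (zs ! i) (zs ! j) \<longleftrightarrow> j = Suc i \<or> i = Suc j"
proof -
  have less: "E (zs ! i) (zs ! j) \<longleftrightarrow> j = Suc i" if "i < j" "j < length zs" for i j
  proof -
    have "nbrs E U (zs ! i) = insert (zs ! Suc i) (if i = 0 then {} else {zs ! (i - 1)})"
      using assms(1) that unfolding thread_iff_nth by simp
    moreover have "E (zs ! i) (zs ! j) \<longleftrightarrow> zs ! j \<in> nbrs E U (zs ! i)"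
      using assms(3) that by (auto simp: nbrs_def)
    moreover have "zs ! j = zs ! k \<longleftrightarrow> j = k" if "k < length zs" for k
      using assms(2) that \<open>j < length zs\<close> by (simp add: nth_eq_iff_index_eq)
    ultimately show ?thesis using that by auto
  qed
  consider "i < j" | "i = j" | "j < i" by linarith
  then show ?thesis
  proof cases
    case 1
    then show ?thesis using less[of i j] assms by auto
  next
    case 2
    then show ?thesis by (simp add: adj_irrefl)
  next
    case 3
    then show ?thesis using less[of j i] assms adj_sym by auto
  qed
qed

lemma alt_path:
  assumes "thread E (set zs) {} zs" "distinct zs"
  shows "alt_count E (set zs) = 0 \<longleftrightarrow> length zs mod 3 = 1"
proof -
  have "nbrs E (set zs) (last zs) \<subseteq> set zs" by (auto simp: nbrs_def)
  \<comment> \<open>The empty graph is a perfect matching.\<close>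
  moreover have "alt_count E {} \<noteq> 0"
    using alt_matching[of "{}"] by simp
  ultimately show ?thesis
    using path_component_alt[of "set zs" zs] assms by simp
qed

text \<open>\<open>T\<close> is attached to the rest only at \<open>u\<close>. A set closed in
  \<open>U - T\<close> becomes closed in \<open>U\<close> after adding \<open>T\<close> if it
  contains \<open>u\<close>, and is closed already if it does not.\<close>

lemma connected_on_Diff:
  assumes conn: "connected_on E U" and u: "u \<in> U" "u \<notin> T" and "T \<subseteq> U"
    and closed: "\<And>x. x \<in> T \<Longrightarrow> nbrs E U x \<subseteq> insert u T"
  shows "connected_on E (U - T)"
  unfolding connected_on_def
proof (intro allI impI)
  fix X assume X: "X \<subseteq> U - T" "X \<noteq> {}" "\<forall>x\<in>X. nbrs E (U - T) x \<subseteq> X"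
  have nbrs_X: "nbrs E U x \<subseteq> X \<union> T" if "x \<in> X" for x
    using X(3) that by (auto simp: nbrs_Diff)
  show "X = U - T"
  proof (cases "u \<in> X")
    case True
    have "X \<union> T = U"
      by (rule connected_onD[OF conn]) (use X \<open>T \<subseteq> U\<close> nbrs_X closed True in blast)+
    then show ?thesis using X(1) by blast
  next
    case False
    have "nbrs E U x \<subseteq> X" if "x \<in> X" for x
    proof
      fix y assume y: "y \<in> nbrs E U x"
      have "x \<in> nbrs E U y" using y X(1) that by (auto intro: nbrs_sym)
      then have "y \<notin> T" using closed[of y] X(1) that False by blast
      then show "y \<in> X" using nbrs_X[OF that] y by blast
    qed
    then have "X = U" using X by (intro connected_onD[OF conn]) auto
    then show ?thesis using False u by blast
  qed
qed

lemma connected_on_walk: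
  assumes "successively E zs"
  shows "connected_on E (set zs)"
proof -
  \<comment> \<open>The induction runs over tails \<open>ws\<close>, while closedness of
    \<open>X\<close> keeps referring to the whole of \<open>zs\<close>.\<close>
  have "set ws \<subseteq> X"
    if "successively E ws" "set ws \<subseteq> set zs" "X \<inter> set ws \<noteq> {}" "\<forall>x\<in>X. nbrs E (set zs) x \<subseteq> X" for ws X
    using that
  proof (induction ws)
    case (Cons z ws)
    show ?case
    proof (cases ws)
      case Nil
      then show ?thesis using Cons.prems by auto
    next
      case ws: (Cons z' ws')
      have zz': "E z z'" "z \<in> set zs" "z' \<in> set zs" "successively E ws" using Cons.prems ws by auto
      then have "z \<in> X \<longleftrightarrow> z' \<in> X" using Cons.prems(4) adj_sym by (auto simp: nbrs_def)
      then have "X \<inter> set ws \<noteq> {}" using Cons.prems(3) ws by auto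
      then have "set ws \<subseteq> X" using Cons.IH Cons.prems zz' by auto
      then show ?thesis using \<open>z \<in> X \<longleftrightarrow> z' \<in> X\<close> ws by auto
    qed
  qed simp
  from this[OF assms subset_refl] show ?thesis
    unfolding connected_on_def by (metis inf.absorb1 subset_antisym)
qed

text \<open>A longest thread from \<open>w\<close> ends either at a branching point or at a vertex
  with no neighbour outside it. In the latter case the thread is closed under neighbours, hence
  everything by connectedness.\<close>

lemma leaf_thread:
  assumes fin: "finite U" and conn: "connected_on E U" and w: "w \<in> U" "card (nbrs E U w) \<le> 1"
  obtains (path) zs where "distinct zs" "set zs = U" "thread E U {} zs"
    | (pendant) ys u where "pendant E U ys u" "w \<in> set ys" "card (nbrs E U u) > 2"
proof -
  define Z where "Z zs \<longleftrightarrow> zs \<noteq> [] \<and> hd zs = w \<and> distinct zs \<and> set zs \<subseteq> U \<and> thread E U {} zs" for zs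
  have "Z [w]" using w by (simp add: Z_def)
  moreover have "\<forall>zs. Z zs \<longrightarrow> length zs < Suc (card U)"
    using card_mono[OF fin] by (auto simp: Z_def less_Suc_eq_le distinct_card[symmetric])
  ultimately obtain zs where zs: "Z zs" and max: "\<And>zs'. Z zs' \<Longrightarrow> length zs' \<le> length zs"
    using ex_has_greatest_nat[of Z "[w]" length] by blast
  obtain ys u where yu: "zs = ys @ [u]" using zs by (cases zs rule: rev_cases) (auto simp: Z_def)
  have th: "thread E U {} (ys @ [u])" "distinct (ys @ [u])" "set (ys @ [u]) \<subseteq> U" "hd (ys @ [u]) = w"
    using zs yu by (auto simp: Z_def)
  show thesis
  proof (cases "card (nbrs E U u) > 2")
    case True
    then have "ys \<noteq> []" using th(4) w(2) by auto
    then have "w \<in> set ys" using th(4) by (cases ys) auto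
    then show thesis using pendant[of ys u] th True \<open>ys \<noteq> []\<close> by (auto simp: pendant_def)
  next
    case False
    have "nbrs E U u \<subseteq> set zs"
    proof (rule ccontr)
      assume "\<not> ?thesis"
      then obtain y where y: "y \<in> nbrs E U u" "y \<notin> set zs" by blast
      \<comment> \<open>For \<open>ys = []\<close> the end is \<open>w\<close> itself, of degree at
        most 1; otherwise its degree is at most 2. In both cases \<open>y\<close> and the
        predecessor, if any, account for all neighbours.\<close>
      have "insert y (if ys = [] then {} else {last ys}) = nbrs E U u"
      proof (rule card_seteq)
        show "finite (nbrs E U u)" by (rule finite_nbrs[OF fin])
        have "last ys \<in> nbrs E U u" if "ys \<noteq> []"
        proof (rule nbrs_sym)
          show "last ys \<in> U" using last_in_set[OF that] th(3) by auto
          show "u \<in> nbrs E U (last ys)"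
            using thread_successively[OF th(1)] that by (simp add: successively_append_iff)
        qed
        then show "insert y (if ys = [] then {} else {last ys}) \<subseteq> nbrs E U u" using y by auto
        have "y \<noteq> last ys" if "ys \<noteq> []" using that y yu by auto
        then show "card (nbrs E U u) \<le> card (insert y (if ys = [] then {} else {last ys}))"
          using False w(2) th(4) by auto
      qed
      then have "thread E U {} (ys @ [u, y])" using thread_snoc[OF th(1), of y] by simp
      moreover have "y \<in> U" using y by (auto simp: nbrs_def)
      ultimately have "Z (ys @ [u, y])" using th y yu by (cases ys) (auto simp: Z_def)
      then show False using max yu by fastforce
    qed
    moreover have "nbrs E U x \<subseteq> set zs" if "x \<in> set ys" for x
      using thread_nbrs[OF th(1) that] yu by auto
    ultimately have "set zs = U"
      by (intro connected_onD[OF conn]) (use th yu in auto)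
    then show thesis using path[of zs] th yu by simp
  qed
qed

text \<open>
  Deleting all branches \<open>T\<close> at branching points leaves a forest.  A vertex with at most one
  neighbour there must be a branching point that has lost at least two neighbours to \<open>T\<close>.
\<close>

lemma tree_cases:
  assumes fin: "finite U" and conn: "connected_on E U" and forest: "forest_on E U" and "U \<noteq> {}"
  obtains (path) zs where "distinct zs" "set zs = U" "thread E U {} zs"
    | (branching) u ys ys' where "card (nbrs E U u) > 2" "pendant E U ys u" "pendant E U ys' u" "ys \<noteq> ys'"
proof -
  define T where "T = \<Union>{set ys |ys u. pendant E U ys u \<and> card (nbrs E U u) > 2}"
  have T_deg: "card (nbrs E U x) \<le> 2" if "x \<in> T" for x
    using that thread_card_nbrs[of E U "{}"] by (auto simp: T_def pendant_def)
  have T_nbrs: "\<exists>ys. pendant E U ys w \<and> x \<in> set ys" "card (nbrs E U w) > 2"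
    if x: "x \<in> T" and w: "w \<in> nbrs E U x" "w \<notin> T" for x w
  proof -
    obtain ys u where ys: "pendant E U ys u" "card (nbrs E U u) > 2" "x \<in> set ys"
      using x by (auto simp: T_def)
    have "set ys \<subseteq> T" using ys by (auto simp: T_def)
    then have "w = u" using thread_nbrs[of E U "{}" ys u x] ys w by (auto simp: pendant_def)
    then show "\<exists>ys. pendant E U ys w \<and> x \<in> set ys" "card (nbrs E U w) > 2" using ys by auto
  qed
  show thesis
  proof (cases "U - T = {}")
    case True
    then obtain w where w: "w \<in> U" "card (nbrs E U w) \<le> 1"
      using forest \<open>U \<noteq> {}\<close> unfolding forest_on_def by blast
    \<comment> \<open>A branch found from \<open>w\<close> would have its root in \<open>T\<close>,
      where all degrees are at most 2; so only the path remains.\<close>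
    show thesis
    proof (rule leaf_thread[OF fin conn w])
      fix ys u assume u: "pendant E U ys u" "2 < card (nbrs E U u)"
      then have "u \<in> U" by (simp add: pendant_def)
      then have "u \<in> T" using True by blast
      then show thesis using T_deg[of u] u by simp
    qed (rule path)
  next
    case False
    then obtain w where w: "w \<in> U - T" "card (nbrs E (U - T) w) \<le> 1"
      using forest unfolding forest_on_def by (meson Diff_subset)
    show thesis
    proof (cases "nbrs E U w \<inter> T = {}")
      case True
      then have "nbrs E (U - T) w = nbrs E U w" by (auto simp: nbrs_Diff)
      then have w': "w \<in> U" "card (nbrs E U w) \<le> 1" using w by auto
      \<comment> \<open>Here \<open>w\<close> has low degree in \<open>U\<close> itself, so a branch
        starting from it would put it into \<open>T\<close>; again only the path remains.\<close>
      show thesis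
      proof (rule leaf_thread[OF fin conn w'])
        fix ys u assume "pendant E U ys u" "2 < card (nbrs E U u)" "w \<in> set ys"
        then have "w \<in> T" by (auto simp: T_def)
        then show thesis using w by simp
      qed (rule path)
    next
      case False
      then obtain x where x: "x \<in> T" "x \<in> nbrs E U w" by blast
      have wx: "w \<in> nbrs E U x" using x w nbrs_sym by blast
      have deg: "card (nbrs E U w) > 2" using T_nbrs(2)[OF x(1) wx] w by simp
      \<comment> \<open>The degree of \<open>w\<close> falls from at least 3 to at most 1, so two of
        its neighbours lie in \<open>T\<close>. Each is the last vertex of its branch, so these
        branches differ.\<close>
      have "\<not> nbrs E U w \<inter> T \<subseteq> {x}"
      proof
        assume "nbrs E U w \<inter> T \<subseteq> {x}"
        then have "nbrs E U w \<subseteq> insert x (nbrs E (U - T) w)" by (auto simp: nbrs_Diff)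
        then have "card (nbrs E U w) \<le> card (insert x (nbrs E (U - T) w))"
          using fin by (intro card_mono) (auto simp: finite_nbrs)
        also have "\<dots> \<le> Suc (card (nbrs E (U - T) w))" by (rule card_insert_le_m1) auto
        finally show False using deg w(2) by simp
      qed
      then obtain x' where x': "x' \<in> T" "x' \<in> nbrs E U w" "x' \<noteq> x" by blast
      have wx': "w \<in> nbrs E U x'" using x' w nbrs_sym by blast
      obtain ys ys' where ys: "pendant E U ys w" "x \<in> set ys" "pendant E U ys' w" "x' \<in> set ys'"
        using T_nbrs(1)[OF x(1) wx] T_nbrs(1)[OF x'(1) wx'] w by blast
      have "x = last ys" "x' = last ys'"
        using thread_nbrs_last[of E U "{}" ys w x] thread_nbrs_last[of E U "{}" ys' w x'] ys wx wx'
        by (auto simp: pendant_def)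
      then have "ys \<noteq> ys'" using x'(3) by auto
      then show thesis using branching deg ys by blast
    qed
  qed
qed

end

section \<open>Moves and reduction to a path\<close>

definition adj :: "('a, 'b) pre_digraph \<Rightarrow> 'a \<Rightarrow> 'a \<Rightarrow> bool" where
  "adj G x y \<longleftrightarrow> (x, y) \<in> arcs_ends G"

abbreviation alt_graph :: "('a, 'b) pre_digraph \<Rightarrow> int" where
  "alt_graph G \<equiv> alt_count (adj G) (verts G)"

section \<open>Induced subgraphs, degrees and pure branches\<close>

lemma nbrs_cong:
  "(\<And>x y. x \<in> U \<Longrightarrow> y \<in> U \<Longrightarrow> E x y \<longleftrightarrow> E' x y) \<Longrightarrow> x \<in> U \<Longrightarrow> nbrs E U x = nbrs E' U x"
  by (auto simp: nbrs_def)

lemma adj_induce: "x \<in> W \<Longrightarrow> y \<in> W \<Longrightarrow> adj (G \<restriction> W) x y \<longleftrightarrow> adj G x y"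
  by (auto simp: adj_def arcs_ends_conv)

lemma nbrs_induce: "x \<in> W \<Longrightarrow> nbrs (adj (G \<restriction> W)) W x = nbrs (adj G) W x"
  by (rule nbrs_cong) (auto simp: adj_induce)

lemma connected_on_induce: "connected_on (adj G) W \<Longrightarrow> connected_on (adj (G \<restriction> W)) W"
  unfolding connected_on_def by (metis nbrs_induce subsetD)

lemma forest_on_induce:
  assumes "forest_on (adj G) W"
  shows "forest_on (adj (G \<restriction> W)) W"
proof -
  have "nbrs (adj (G \<restriction> W)) V x = nbrs (adj G) V x" if "V \<subseteq> W" "x \<in> V" for V x
    by (rule nbrs_cong) (use that in \<open>auto simp: adj_induce subsetD\<close>)
  then show ?thesis using assms unfolding forest_on_def by (metis subsetD)
qed

lemma alt_graph_induce: "alt_graph (G \<restriction> W) = alt_count (adj G) W"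
  by (simp, rule alt_cong) (simp add: adj_induce)

lemma (in graph) graph_induce:
  assumes "W \<subseteq> verts G"
  shows "graph (G \<restriction> W)"
proof
  show "symmetric (G \<restriction> W)"
    using sym_arcs assms induced_graph_imp_symmetric by blast
qed (auto simp: no_loops arc_to_ends_def intro: no_multi_arcs finite_subset[OF assms])

lemma graph_simple_graph: "graph G \<Longrightarrow> simple_graph (adj G)"
proof
  assume "graph G"
  then interpret graph G .
  show "adj G x y \<Longrightarrow> adj G y x" for x y by (simp add: adj_def graph_symmetric)
  show "\<not> adj G x x" for x by (auto simp: adj_def arcs_ends_conv no_loops)
qed

lemma (in graph) out_degree_nbrs: "out_degree G v = card (nbrs (adj G) (verts G) v)"
proof -
  have "bij_betw (head G) (out_arcs G v) (nbrs (adj G) (verts G) v)"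
    unfolding bij_betw_def
  proof
    show "inj_on (head G) (out_arcs G v)"
      by (auto intro!: inj_onI no_multi_arcs simp: arc_to_ends_def)
    show "head G ` out_arcs G v = nbrs (adj G) (verts G) v"
      by (auto simp: nbrs_def adj_def arcs_ends_conv image_iff)
  qed
  then show ?thesis by (simp add: out_degree_def bij_betw_same_card)
qed

lemma set_vwalk_arcs_subset_iff: "set (vwalk_arcs p) \<subseteq> arcs_ends G \<longleftrightarrow> successively (adj G) p"
  by (induction p rule: vwalk_arcs.induct) (auto simp: adj_def)

lemma vpath_iff: "vpath p G \<longleftrightarrow> p \<noteq> [] \<and> distinct p \<and> set p \<subseteq> verts G \<and> successively (adj G) p"
  by (auto simp: vpath_def vwalk_def set_vwalk_arcs_subset_iff)

lemma (in graph) successively_adj_rev: "successively (adj G) (rev p) \<longleftrightarrow> successively (adj G) p"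
proof -
  interpret simple_graph "adj G" by (rule graph_simple_graph) unfold_locales
  have "(\<lambda>x y. adj G y x) = adj G" using adj_sym by blast
  then show ?thesis unfolding successively_rev by (rule arg_cong)
qed

text \<open>\<open>pure_branch\<close> starts at the root and bounds degrees; \<open>pendant\<close>
  starts at the leaf and fixes neighbourhoods. Along a path the bounds determine the neighbourhoods
  by \<open>threadI\<close>, and these in turn give back the degrees.\<close>

lemma (in graph) pure_branch_iff:
  "pure_branch G u p \<longleftrightarrow>
   branching_point G u \<and> (\<exists>ys. p = u # rev ys \<and> pendant (adj G) (verts G) ys u)"
proof -
  interpret S: simple_graph "adj G" by (rule graph_simple_graph) unfold_locales
  show ?thesis
  proof (intro iffI conjI; (elim conjE exE)?)
    assume p: "pure_branch G u p"
    then show u: "branching_point G u" by (simp add: pure_branch_def)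
    obtain xs where xs: "p = u # xs" using p by (cases p) (auto simp: pure_branch_def vpath_iff)
    have path: "distinct p" "set p \<subseteq> verts G" "successively (adj G) p"
      and leaf: "leaf G (last p)" and deg: "\<And>v. v \<in> set xs \<Longrightarrow> out_degree G v \<le> 2"
      using p xs by (auto simp: pure_branch_def vpath_iff)
    \<comment> \<open>A branch consisting of \<open>u\<close> alone would make a branching point a
      leaf.\<close>
    have "xs \<noteq> []" using u leaf xs by (auto simp: branching_point_def leaf_def)
    have "thread (adj G) (verts G) {} (rev p)"
    proof (rule S.threadI)
      show "successively (adj G) (rev p)" using path by (simp only: successively_adj_rev)
      show "card (nbrs (adj G) (verts G) (hd (rev p))) \<le> Suc (card {})"
        using leaf by (simp add: leaf_def out_degree_nbrs hd_rev)
      fix z assume "z \<in> set (tl (butlast (rev p)))"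
      then have "z \<in> set xs" using xs \<open>xs \<noteq> []\<close> by (auto dest!: list.set_sel(2)[rotated])
      then show "card (nbrs (adj G) (verts G) z) \<le> 2" using deg out_degree_nbrs by simp
    qed (use path in auto)
    then have "pendant (adj G) (verts G) (rev xs) u"
      using path xs \<open>xs \<noteq> []\<close> by (auto simp: pendant_def)
    then show "\<exists>ys. p = u # rev ys \<and> pendant (adj G) (verts G) ys u"
      using xs by (intro exI[of _ "rev xs"]) simp
  next
    fix ys assume u: "branching_point G u" and p: "p = u # rev ys" and ys: "pendant (adj G) (verts G) ys u"
    have rev: "p = rev (ys @ [u])" using p by simp
    have "successively (\<lambda>x y. y \<in> nbrs (adj G) (verts G) x) (ys @ [u])"
      using thread_successively ys by (auto simp: pendant_def)
    then have "successively (adj G) (ys @ [u])"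
      by (rule successively_mono) (auto simp: nbrs_def)
    then have "successively (adj G) p" unfolding rev by (simp only: successively_adj_rev)
    then have "vpath p G" using ys p by (auto simp: vpath_iff pendant_def)
    moreover have "leaf G (last p)"
    proof -
      obtain z zs where z: "ys = z # zs" using ys by (cases ys) (auto simp: pendant_def)
      have "nbrs (adj G) (verts G) z = {hd (zs @ [u])}" using ys z by (cases zs) (auto simp: pendant_def)
      then show ?thesis using ys z p by (simp add: leaf_def out_degree_nbrs pendant_def)
    qed
    moreover have "out_degree G v \<le> 2" if "v \<in> set p - {u}" for v
      using thread_card_nbrs[of "adj G" "verts G" "{}" ys u v] that ys p
      by (auto simp: pendant_def out_degree_nbrs)
    ultimately show "pure_branch G u p" using u p by (simp add: pure_branch_def)
  qed
qed

text \<open>For the first move both counts vanish, whatever is discarded. The second removes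
  branches beside a kept one of the same type; the third is the case of \<open>thread_alt\<close> in
  which the root is left untouched.\<close>

lemma move_alt:
  assumes "move G G'" "graph G"
  shows "graph G'" "alt_graph G' = 0 \<longleftrightarrow> alt_graph G = 0"
proof -
  interpret graph G by fact
  interpret S: simple_graph "adj G" by (rule graph_simple_graph) fact
  let ?E = "adj G" and ?U = "verts G"
  have "\<exists>W\<subseteq>?U. G' = G \<restriction> W \<and> (alt_count ?E W = 0 \<longleftrightarrow> alt_count ?E ?U = 0)"
    using assms(1)
  proof cases
    case (keep_types_1_2 u p q)
    obtain ys zs where ys: "p = u # rev ys" "pendant ?E ?U ys u" and zs: "q = u # rev zs" "pendant ?E ?U zs u"
      using keep_types_1_2 pure_branch_iff by metis
    have types: "length ys mod 3 = 1" "length zs mod 3 = 2"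
      using keep_types_1_2 ys zs by (auto simp: branch_type_def)
    then have disj: "set ys \<inter> set zs = {}" using S.pendant_disjoint[OF ys(2) zs(2)] by fastforce
    let ?W = "set p \<union> set q"
    have WU: "?W \<subseteq> ?U" using ys zs by (auto simp: pendant_def)
    \<comment> \<open>The kept set is written as a complement so that \<open>pendant_Diff\<close>
      applies.\<close>
    then have W: "?U - (?U - ?W) = ?W" by blast
    have "pendant ?E ?W ys u" "pendant ?E ?W zs u"
      using pendant_Diff[OF ys(2), of "?U - ?W"] pendant_Diff[OF zs(2), of "?U - ?W"] ys(1) zs(1)
      unfolding W by auto
    then have "alt_count ?E ?W = 0" using WU finite_subset by (intro S.pendants_1_2_alt[OF _ _ _ disj types]) auto
    moreover have "alt_count ?E ?U = 0" using ys zs by (intro S.pendants_1_2_alt[OF _ _ _ disj types]) auto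
    ultimately show ?thesis using keep_types_1_2(1) WU by (intro exI[of _ ?W]) simp
  next
    case (keep_one_of_type B u t p)
    define C where "C = {ys. u # rev ys \<in> B - {p}}"
    let ?W = "?U - (\<Union>q\<in>B - {p}. set q - {u})"
    obtain ys where ys: "p = u # rev ys" "pendant ?E ?U ys u" "length ys mod 3 = t"
      using keep_one_of_type pure_branch_iff by (fastforce simp: branch_type_def)
    have C: "pendant ?E ?U zs u \<and> length zs mod 3 = length ys mod 3" if "zs \<in> C" for zs
      using that ys(3) pure_branch_iff unfolding C_def keep_one_of_type(2) by (auto simp: branch_type_def)
    have "B - {p} = (\<lambda>zs. u # rev zs) ` C"
      using pure_branch_iff unfolding C_def keep_one_of_type(2) by fastforce
    then have "(\<Union>q\<in>B - {p}. set q - {u}) = \<Union>(set ` C)"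
      using C by (auto simp: pendant_def)
    moreover have "finite C"
      by (rule finite_subset[OF _ finite_subset_distinct[of ?U]]) (use C in \<open>auto simp: pendant_def\<close>)
    moreover have "ys \<notin> C" by (simp add: C_def ys(1))
    ultimately have "alt_count ?E ?U = 0 \<longleftrightarrow> alt_count ?E ?W = 0"
      using S.remove_same_type_pendants_alt[of C ?U ys u] ys(2) C by simp
    then show ?thesis using keep_one_of_type(1) by (intro exI[of _ ?W]) auto
  next
    case (remove_type_0 u p)
    obtain ys where ys: "p = u # rev ys" "pendant ?E ?U ys u"
      using remove_type_0 pure_branch_iff by metis
    have "set p - {u} = set ys" using ys by (auto simp: pendant_def)
    moreover have "length ys mod 3 = 0" using remove_type_0 ys by (simp add: branch_type_def)
    ultimately have "alt_count ?E ?U = 0 \<longleftrightarrow> alt_count ?E (?U - (set p - {u})) = 0"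
      using S.thread_alt[of ?U ys u] ys by (simp add: pendant_def)
    then show ?thesis using remove_type_0(1) by (intro exI[of _ "?U - (set p - {u})"]) auto
  qed
  then obtain W where "W \<subseteq> ?U" "G' = G \<restriction> W" "alt_count ?E W = 0 \<longleftrightarrow> alt_count ?E ?U = 0" by blast
  then show "graph G'" "alt_graph G' = 0 \<longleftrightarrow> alt_graph G = 0"
    using graph_induce alt_graph_induce[of G W] by simp_all
qed

lemma moves_alt:
  assumes "move\<^sup>*\<^sup>* G G'" "graph G"
  shows "graph G' \<and> (alt_graph G' = 0 \<longleftrightarrow> alt_graph G = 0)"
  using assms by (induction rule: rtranclp_induct) (use move_alt in blast)+

section \<open>Graphs isomorphic to a path\<close>

lemma (in graph) alt_graph_iso_path:
  assumes "digraph_iso G (path_graph n)"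
  shows "alt_graph G = 0 \<longleftrightarrow> n mod 3 = 1"
proof -
  interpret S: simple_graph "adj G" by (rule graph_simple_graph) unfold_locales
  obtain f where f: "digraph_isomorphism f" and path: "path_graph n = app_iso f G"
    using assms by (auto simp: digraph_iso_def)
  let ?h = "iso_verts f"
  have inj: "inj_on ?h (verts G)" using f by (rule digraph_isomorphism_inj_on_verts)
  have img: "?h ` verts G = {..<n}" using path by (simp add: path_graph_def app_iso_def)
  have "iso_tail f = fst" "iso_head f = snd" using path by (simp_all add: path_graph_def app_iso_def)
  then have ends: "iso_arcs f e = (?h (tail G e), ?h (head G e))" if "e \<in> arcs G" for e
    using iso_verts_tail[OF f that] iso_verts_head[OF f that] by (simp add: prod_eq_iff)
  have arcs: "iso_arcs f ` arcs G = {(i, j). i < n \<and> j < n \<and> (j = Suc i \<or> i = Suc j)}"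
    using path by (simp add: path_graph_def app_iso_def)
  have adj_iff: "adj G x y \<longleftrightarrow> ?h y = Suc (?h x) \<or> ?h x = Suc (?h y)"
    if "x \<in> verts G" "y \<in> verts G" for x y
  proof -
    have lt: "?h x < n" "?h y < n" using img that by auto
    have "adj G x y \<longleftrightarrow> (\<exists>e\<in>arcs G. tail G e = x \<and> head G e = y)"
      by (auto simp: adj_def arcs_ends_conv)
    also have "\<dots> \<longleftrightarrow> (?h x, ?h y) \<in> iso_arcs f ` arcs G"
      using ends that inj by (auto simp: image_iff dest: inj_onD intro!: bexI)
    also have "\<dots> \<longleftrightarrow> ?h y = Suc (?h x) \<or> ?h x = Suc (?h y)"
      unfolding arcs using lt by auto
    finally show ?thesis .
  qed
  define g where "g = the_inv_into (verts G) ?h"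
  have g: "g i \<in> verts G" "?h (g i) = i" if "i < n" for i
    using that img inj by (auto simp: g_def the_inv_into_into f_the_inv_into_f)
  have gh: "g (?h x) = x" if "x \<in> verts G" for x
    using that inj by (simp add: g_def the_inv_into_f_f)
  define zs where "zs = map g [0..<n]"
  have set_zs: "set zs = verts G"
  proof -
    have "set zs = (\<lambda>x. g (?h x)) ` verts G"
      by (simp add: zs_def atLeast0LessThan img[symmetric] image_image)
    also have "\<dots> = (\<lambda>x. x) ` verts G" by (rule image_cong) (simp_all add: gh)
    finally show ?thesis by simp
  qed
  have "inj_on g {0..<n}" using g by (metis atLeastLessThan_iff inj_onI)
  then have "distinct zs" by (simp add: zs_def distinct_map)
  moreover have "thread (adj G) (set zs) {} zs"
    unfolding thread_iff_nth
  proof (intro allI impI)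
    fix i assume "Suc i < length zs"
    then have i: "Suc i < n" by (simp add: zs_def)
    have nth: "zs ! k = g k" if "k < n" for k using that by (simp add: zs_def)
    have "y \<in> nbrs (adj G) (set zs) (zs ! i) \<longleftrightarrow>
      y \<in> insert (zs ! Suc i) (if i = 0 then {} else {zs ! (i - 1)})" for y
    proof (cases "y \<in> verts G")
      case True
      then have "y \<in> nbrs (adj G) (set zs) (zs ! i) \<longleftrightarrow> ?h y = Suc i \<or> i = Suc (?h y)"
        using i g adj_iff[of "g i" y] by (simp add: set_zs nbrs_def nth)
      moreover have "y = g j \<longleftrightarrow> ?h y = j" if "j < n" for j using gh[OF True] g(2)[OF that] by metis
      ultimately show ?thesis using i by (auto simp: nth)
    next
      case False
      then show ?thesis using i g by (auto simp: set_zs nbrs_def nth)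
    qed
    then show "nbrs (adj G) (set zs) (zs ! i) = insert (zs ! Suc i) (if i = 0 then {} else {zs ! (i - 1)})"
      by blast
  qed
  ultimately show ?thesis using S.alt_path[of zs] set_zs by (simp add: zs_def)
qed

lemma (in graph) digraph_iso_path:
  assumes zs: "distinct zs" "set zs = verts G" "thread (adj G) (verts G) {} zs"
  shows "digraph_iso G (path_graph (length zs))"
proof -
  interpret S: simple_graph "adj G" by (rule graph_simple_graph) unfold_locales
  let ?n = "length zs"
  define h where "h = the_inv_into {..<?n} ((!) zs)"
  have inj: "inj_on ((!) zs) {..<?n}" using zs(1) by (simp add: inj_on_nth)
  have img: "(!) zs ` {..<?n} = verts G" using zs(2) by (auto simp: set_conv_nth)
  have h: "h x < ?n" "zs ! h x = x" if "x \<in> verts G" for x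
    using that the_inv_into_into[OF inj, of x] f_the_inv_into_f[OF inj, of x] img by (auto simp: h_def)
  have h_nth: "h (zs ! i) = i" if "i < ?n" for i
    using that inj by (simp add: h_def the_inv_into_f_f)
  have adj_nth: "adj G (zs ! i) (zs ! j) \<longleftrightarrow> j = Suc i \<or> i = Suc j" if "i < ?n" "j < ?n" for i j
    using S.thread_adj[OF zs(3,1)] zs(2) that by simp
  define f :: "('a, 'b, nat, nat \<times> nat) digraph_isomorphism" where
    "f = \<lparr> iso_verts = h, iso_arcs = (\<lambda>e. (h (tail G e), h (head G e))), iso_head = snd, iso_tail = fst \<rparr>"
  have inj_h: "x = y" if "x \<in> verts G" "y \<in> verts G" "h x = h y" for x y
    using h that by metis
  have "digraph_isomorphism f"
    unfolding digraph_isomorphism_def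
  proof (intro conjI ballI)
    show "inj_on (iso_arcs f) (arcs G)"
      by (rule inj_onI) (auto simp: f_def arc_to_ends_def intro!: no_multi_arcs inj_h)
  qed (auto simp: f_def inj_on_def inj_h wf_digraph)
  moreover have "path_graph ?n = app_iso f G"
  proof -
    have "h ` verts G = {..<?n}"
    proof (intro subset_antisym subsetI)
      fix i assume "i \<in> {..<?n}"
      then have "zs ! i \<in> verts G" "i = h (zs ! i)" using h_nth img by auto
      then show "i \<in> h ` verts G" by blast
    qed (use h in auto)
    moreover have "(\<lambda>e. (h (tail G e), h (head G e))) ` arcs G =
      {(i, j). i < ?n \<and> j < ?n \<and> (j = Suc i \<or> i = Suc j)}" (is "?A = ?B")
    proof (intro subset_antisym subsetI)
      fix x assume "x \<in> ?A"
      then obtain e where e: "e \<in> arcs G" "x = (h (tail G e), h (head G e))" by blast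
      have "adj G (tail G e) (head G e)" using e by (auto simp: adj_def arcs_ends_conv)
      then show "x \<in> ?B"
        using e h[of "tail G e"] h[of "head G e"] adj_nth[of "h (tail G e)" "h (head G e)"] by simp
    next
      fix x assume "x \<in> ?B"
      then obtain i j where x: "x = (i, j)" "i < ?n" "j < ?n" "j = Suc i \<or> i = Suc j" by blast
      then have "adj G (zs ! i) (zs ! j)" using adj_nth by simp
      then obtain e where "e \<in> arcs G" "tail G e = zs ! i" "head G e = zs ! j"
        by (auto simp: adj_def arcs_ends_conv)
      then show "x \<in> ?A" using x h_nth by (auto simp: image_iff intro!: bexI[of _ e])
    qed
    ultimately show ?thesis by (simp add: path_graph_def app_iso_def f_def)
  qed
  ultimately show ?thesis by (auto simp: digraph_iso_def)
qed

text \<open>Induction on the number of vertices. Besides the existence of a move, each step has to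
  leave a nonempty, connected and strictly smaller forest; the local fact \<open>remove\<close>
  settles this for the second and third moves together.\<close>

lemma reducible_to_path:
  assumes "graph G" "connected_on (adj G) (verts G)" "forest_on (adj G) (verts G)" "verts G \<noteq> {}"
  shows "\<exists>n. reducible_to G (path_graph n)"
  using assms
proof (induction "card (verts G)" arbitrary: G rule: less_induct)
  case less
  interpret graph G by fact
  interpret S: simple_graph "adj G" by (rule graph_simple_graph) fact
  let ?E = "adj G" and ?U = "verts G"
  have step: ?case
    if "move G (G \<restriction> W)" "W \<subset> ?U" "W \<noteq> {}" "connected_on ?E W" for W
  proof -
    have "\<exists>n. reducible_to (G \<restriction> W) (path_graph n)"
    proof (rule less.hyps)
      show "card (verts (G \<restriction> W)) < card ?U" using that by (simp add: psubset_card_mono)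
      show "graph (G \<restriction> W)" using that by (intro graph_induce) auto
      show "forest_on (adj (G \<restriction> W)) (verts (G \<restriction> W))"
        using forest_on_subset[OF less.prems(3)] that by (auto intro: forest_on_induce)
    qed (use that in \<open>auto intro: connected_on_induce\<close>)
    then show ?thesis
      using that(1) unfolding reducible_to_def by (meson converse_rtranclp_into_rtranclp)
  qed
  show ?case
  proof (rule S.tree_cases[OF finite_verts less.prems(2-4)])
    fix zs assume "distinct zs" "set zs = ?U" "thread ?E ?U {} zs"
    then show ?case using digraph_iso_path unfolding reducible_to_def by blast
  next
    fix u ys zs
    assume deg: "2 < card (nbrs ?E ?U u)" and ys: "pendant ?E ?U ys u" and zs: "pendant ?E ?U zs u"
      and neq: "ys \<noteq> zs"
    have u: "branching_point G u" using deg ys by (simp add: branching_point_def out_degree_nbrs pendant_def)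
    have branch: "pure_branch G u (u # rev xs)" if "pendant ?E ?U xs u" for xs
      using u that pure_branch_iff by blast
    have remove: ?case if C: "C \<noteq> {}" "\<And>xs. xs \<in> C \<Longrightarrow> pendant ?E ?U xs u"
      and move: "move G (G \<restriction> (?U - \<Union>(set ` C)))" for C
    proof (rule step[OF move])
      have T: "\<Union>(set ` C) \<subseteq> ?U" "u \<notin> \<Union>(set ` C)" "u \<in> ?U"
        using C(2) ys by (auto simp: pendant_def)
      obtain xs where xs: "xs \<in> C" using C(1) by blast
      then have "hd xs \<in> set xs" using C(2) by (auto simp: pendant_def)
      then have "hd xs \<in> \<Union>(set ` C)" by (rule UN_I[OF xs])
      then show "?U - \<Union>(set ` C) \<subset> ?U" using T(1) by blast
      show "?U - \<Union>(set ` C) \<noteq> {}" using T(2,3) by blast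
      show "connected_on ?E (?U - \<Union>(set ` C))"
      proof (rule S.connected_on_Diff[OF less.prems(2) T(3,2,1)])
        fix x assume "x \<in> \<Union>(set ` C)"
        then obtain xs where xs: "xs \<in> C" "x \<in> set xs" by blast
        then have "nbrs ?E ?U x \<subseteq> insert u (set xs)"
          using thread_nbrs[of ?E ?U "{}" xs u x] C(2) by (auto simp: pendant_def)
        then show "nbrs ?E ?U x \<subseteq> insert u (\<Union>(set ` C))" using xs by blast
      qed
    qed
    have type_0: ?case if "pendant ?E ?U xs u" "length xs mod 3 = 0" for xs
    proof -
      have "move G (G \<restriction> (?U - (set (u # rev xs) - {u})))"
        using branch[OF that(1)] that(2) by (intro remove_type_0) (auto simp: branch_type_def)
      moreover have "set (u # rev xs) - {u} = \<Union>(set ` {xs})" using that by (auto simp: pendant_def)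
      ultimately show ?thesis using that by (intro remove[of "{xs}"]) auto
    qed
    have types_1_2: ?case if xs: "pendant ?E ?U xs u" "length xs mod 3 = 1"
      and xs': "pendant ?E ?U xs' u" "length xs' mod 3 = 2" for xs xs'
    proof (rule step)
      let ?W = "set (u # rev xs) \<union> set (u # rev xs')"
      show "move G (G \<restriction> ?W)"
        using branch[OF xs(1)] branch[OF xs'(1)] xs(2) xs'(2) by (intro keep_types_1_2) (auto simp: branch_type_def)
      \<comment> \<open>The kept vertices form a walk from one leaf through \<open>u\<close> to the
        other, which gives connectedness.\<close>
      let ?ws = "xs @ u # rev xs'"
      have succ: "successively ?E (ys @ [u])" if "pendant ?E ?U ys u" for ys
        using that thread_successively[of ?E ?U "{}" "ys @ [u]"]
        by (auto simp: pendant_def nbrs_def elim!: successively_mono)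
      have "successively ?E (rev (xs' @ [u]))"
        using succ[OF xs'(1)] by (simp only: successively_adj_rev)
      then have "successively ?E ?ws"
        using succ[OF xs(1)] xs(1) by (simp add: successively_append_iff)
      moreover have "?W = set ?ws" by auto
      ultimately show "connected_on ?E ?W" using S.connected_on_walk by metis
      show "?W \<noteq> {}" by simp
      \<comment> \<open>Each branch holds at most one neighbour of \<open>u\<close>, and
        \<open>u\<close> has at least three, so the move really discards something.\<close>
      have "nbrs ?E ?U u \<inter> set ws \<subseteq> {last ws}" if ws: "pendant ?E ?U ws u" for ws
      proof
        fix x assume x: "x \<in> nbrs ?E ?U u \<inter> set ws"
        moreover have "u \<in> nbrs ?E ?U x" using x ws by (auto simp: pendant_def intro: S.nbrs_sym)
        ultimately show "x \<in> {last ws}"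
          using thread_nbrs_last[of ?E ?U "{}" ws u x] ws by (auto simp: pendant_def)
      qed
      then have "nbrs ?E ?U u \<inter> ?W \<subseteq> {last xs, last xs'}"
        using xs(1) xs'(1) S.nbrs_irrefl[of u ?U] by fastforce
      then have "card (nbrs ?E ?U u \<inter> ?W) \<le> card {last xs, last xs'}" by (intro card_mono) auto
      also have "\<dots> \<le> 2" by (simp add: card_insert_if)
      finally have "\<not> nbrs ?E ?U u \<subseteq> ?W" using deg by (auto simp: Int_absorb2)
      moreover have "nbrs ?E ?U u \<subseteq> ?U" by (auto simp: nbrs_def)
      moreover have "?W \<subseteq> ?U" using xs xs' by (auto simp: pendant_def)
      ultimately show "?W \<subset> ?U" by blast
    qed
    have same: ?case if "length ys mod 3 = length zs mod 3"
    proof -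
      define B where "B = {q. pure_branch G u q \<and> branch_type q = length ys mod 3}"
      define C where "C = {xs. pendant ?E ?U xs u \<and> length xs mod 3 = length ys mod 3} - {ys}"
      have B: "B = (\<lambda>xs. u # rev xs) ` insert ys C"
        using u ys unfolding B_def C_def by (auto simp: pure_branch_iff branch_type_def)
      have "zs \<in> C" using zs that neq by (simp add: C_def)
      then have "u # rev zs \<in> B" unfolding B by blast
      then have "B \<noteq> {u # rev ys}" using neq by auto
      moreover have "u # rev ys \<in> B" unfolding B by blast
      ultimately have "move G (G \<restriction> (?U - (\<Union>q\<in>B - {u # rev ys}. set q - {u})))"
        by (intro keep_one_of_type[OF B_def])
      moreover have "B - {u # rev ys} = (\<lambda>xs. u # rev xs) ` C" unfolding B by (auto simp: C_def)
      moreover have "(\<Union>q\<in>(\<lambda>xs. u # rev xs) ` C. set q - {u}) = \<Union>(set ` C)"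
        by (auto simp: C_def pendant_def)
      ultimately show ?thesis
        using \<open>zs \<in> C\<close> by (intro remove[of C]) (auto simp: C_def)
    qed
    \<comment> \<open>Two residues modulo 3 include 0, or agree, or are 1 and 2, so two branches at
      a common root always admit one of the three moves.\<close>
    consider "length ys mod 3 = 0" | "length zs mod 3 = 0" | "length ys mod 3 = length zs mod 3"
      | "length ys mod 3 = 1" "length zs mod 3 = 2" | "length ys mod 3 = 2" "length zs mod 3 = 1"
      by linarith
    then show ?case
    proof cases
      case 1
      then show ?thesis by (rule type_0[OF ys])
    next
      case 2
      then show ?thesis by (rule type_0[OF zs])
    next
      case 3
      then show ?thesis by (rule same)
    next
      case 4
      then show ?thesis by (rule types_1_2[OF ys _ zs])
    next
      case 5
      then show ?thesis using types_1_2[OF zs _ ys] by blast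
    qed
  qed
qed

section \<open>Undirected trees in terms of cuts and degrees\<close>

lemma (in graph) awalk_of_successively:
  assumes "successively (adj G) zs" "zs \<noteq> []" "set zs \<subseteq> verts G"
  shows "\<exists>p. awalk (hd zs) p (last zs) \<and> awalk_verts (hd zs) p = zs"
  using assms
proof (induction zs)
  case (Cons z zs)
  show ?case
  proof (cases zs)
    case Nil
    then show ?thesis using Cons.prems by (intro exI[of _ "[]"]) (simp add: awalk_Nil_iff)
  next
    case zs: (Cons z' zs')
    then obtain p where p: "awalk z' p (last zs)" "awalk_verts z' p = zs"
      using Cons by auto
    obtain e where "e \<in> arcs G" "tail G e = z" "head G e = z'"
      using Cons.prems(1) zs by (auto simp: adj_def arcs_ends_conv)
    then show ?thesis using p zs by (intro exI[of _ "e # p"]) (auto simp: awalk_Cons_iff)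
  qed
qed simp

text \<open>If all degrees in \<open>W\<close> were at least 2, the first vertex of a longest path
  in \<open>W\<close> would have all its neighbours in \<open>W\<close> on that path, and one other
  than the second vertex would close a cycle.\<close>

lemma (in graph) forest_on_if_acyclic:
  assumes acyclic: "\<And>p. cycle p \<Longrightarrow> length p < 3"
  shows "forest_on (adj G) (verts G)"
  unfolding forest_on_def
proof (intro allI impI)
  interpret S: simple_graph "adj G" by (rule graph_simple_graph) unfold_locales
  let ?E = "adj G"
  fix W assume W: "W \<subseteq> verts G" "W \<noteq> {}"
  show "\<exists>w\<in>W. card (nbrs ?E W w) \<le> 1"
  proof (rule ccontr)
    assume "\<not> ?thesis"
    then have deg: "card (nbrs ?E W w) \<ge> 2" if "w \<in> W" for w using that by force
    have fin: "finite W" by (rule finite_subset[OF W(1) finite_verts])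
    define Z where "Z zs \<longleftrightarrow> zs \<noteq> [] \<and> distinct zs \<and> set zs \<subseteq> W \<and> successively ?E zs" for zs
    obtain w where "w \<in> W" using W by blast
    then have "Z [w]" by (simp add: Z_def)
    moreover have "\<forall>zs. Z zs \<longrightarrow> length zs < Suc (card W)"
      using card_mono[OF fin] by (auto simp: Z_def less_Suc_eq_le distinct_card[symmetric])
    ultimately obtain zs where zs: "Z zs" and max: "\<And>zs'. Z zs' \<Longrightarrow> length zs' \<le> length zs"
      using ex_has_greatest_nat[of Z "[w]" length] by blast
    obtain z ws where z: "zs = z # ws" using zs by (cases zs) (auto simp: Z_def)
    have zW: "z \<in> W" using zs z by (simp add: Z_def)
    have in_ws: "y \<in> set ws" if y: "y \<in> nbrs ?E W z" for y
    proof (rule ccontr)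
      assume "y \<notin> set ws"
      moreover have "y \<noteq> z" using y S.nbrs_irrefl by blast
      ultimately have "Z (y # zs)"
        using y zs z by (auto simp: Z_def nbrs_def intro: S.adj_sym)
      then show False using max by fastforce
    qed
    have "\<not> nbrs ?E W z \<subseteq> {hd ws}"
    proof
      assume "nbrs ?E W z \<subseteq> {hd ws}"
      then have "card (nbrs ?E W z) \<le> card {hd ws}" by (intro card_mono) auto
      then show False using deg[OF zW] by simp
    qed
    \<comment> \<open>Avoiding the successor of \<open>z\<close> makes \<open>as\<close> nonempty
      and the closed walk at least three arcs long, so it is not an edge traversed back and
      forth.\<close>
    then obtain y where y: "y \<in> nbrs ?E W z" "y \<noteq> hd ws" by blast
    obtain as bs where ws: "ws = as @ y # bs" using in_ws[OF y(1)] by (meson split_list)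
    then have "as \<noteq> []" using y(2) by auto
    let ?c = "z # as @ [y, z]"
    have "successively ?E ((z # as @ [y]) @ bs)" using zs z ws by (simp add: Z_def)
    then have "successively ?E (z # as @ [y])" by (simp only: successively_append_iff)
    moreover have "?E y z" using y by (auto simp: nbrs_def intro: S.adj_sym)
    ultimately have "successively ?E ((z # as @ [y]) @ [z])"
      unfolding successively_append_iff by simp
    then have "successively ?E ?c" by simp
    then obtain p where p: "awalk z p z" "awalk_verts z p = ?c"
      using awalk_of_successively[of ?c] zs z ws W(1) by (auto simp: Z_def)
    have "length p = length ?c - 1" using length_awalk_verts[of z p] p(2) by simp
    then have len: "length p \<ge> 3" using \<open>as \<noteq> []\<close> by (cases as) auto
    have "distinct (tl ?c)" using zs z ws by (auto simp: Z_def)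
    then have "cycle p" using p len unfolding cycle_def by (intro exI[of _ z]) auto
    then show False using acyclic[of p] len by simp
  qed
qed

lemma (in graph) connected_on_if_connected:
  assumes "Digraph_Component.connected G"
  shows "connected_on (adj G) (verts G)"
  unfolding connected_on_def
proof (intro allI impI)
  fix X assume X: "X \<subseteq> verts G" "X \<noteq> {}" "\<forall>x\<in>X. nbrs (adj G) (verts G) x \<subseteq> X"
  obtain x where x: "x \<in> X" using X by blast
  have "v \<in> X" if "v \<in> verts G" for v
  proof -
    have "x \<rightarrow>\<^sup>*\<^bsub>mk_symmetric G\<^esub> v"
      using assms x X(1) that by (auto simp: Digraph_Component.connected_def strongly_connected_def)
    then have "x \<rightarrow>\<^sup>* v" using reachable_mk_symmetric_eq[OF sym_arcs] by blast
    then show ?thesis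
      unfolding reachable_def
    proof (induction rule: rtrancl_on_induct)
      case (step y z)
      then show ?case using X(3) by (auto simp: nbrs_def adj_def)
    qed (rule x)
  qed
  then show "X = verts G" using X(1) by blast
qed

theorem theorem1p2:
  fixes G :: "('a, 'b) pre_digraph"
  assumes "undirected_tree G"
  shows "contractible_space (geometric_realization (independence_complex G)) \<longleftrightarrow>
         (\<exists>n. n mod 3 = 1 \<and> reducible_to G (path_graph n))"
proof -
  interpret graph G using assms by (simp add: undirected_tree_def)
  interpret S: simple_graph "adj G" by (rule graph_simple_graph) unfold_locales
  have conn: "connected_on (adj G) (verts G)"
    using assms connected_on_if_connected by (simp add: undirected_tree_def)
  have forest: "forest_on (adj G) (verts G)"
    using assms by (intro forest_on_if_acyclic) (auto simp: undirected_tree_def not_le)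
  have nonempty: "verts G \<noteq> {}"
    using assms by (simp add: undirected_tree_def Digraph_Component.connected_def strongly_connected_def)
  have "independence_complex G = indep_sets (adj G) (verts G)"
    by (simp add: independence_complex_def indep_sets_def adj_def)
  then have contractible:
    "contractible_space (geometric_realization (independence_complex G)) \<longleftrightarrow> alt_graph G = 0"
    using S.forest_contractible_iff[OF finite_verts forest nonempty] by simp
  \<comment> \<open>This holds for every path that \<open>G\<close> reduces to, whichever moves were
    made, so any one reduction already shows the right residue.\<close>
  have count: "alt_graph G = 0 \<longleftrightarrow> n mod 3 = 1" if red: "reducible_to G (path_graph n)" for n
  proof -
    obtain K where "move\<^sup>*\<^sup>* G K" "digraph_iso K (path_graph n)"
      using red by (auto simp: reducible_to_def)
    then show ?thesis using moves_alt[of G K] graph_axioms graph.alt_graph_iso_path by metis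
  qed
  show ?thesis
    using contractible count reducible_to_path[OF graph_axioms conn forest nonempty] by blast
qed

end
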